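(* Fix any $1\le s\le n/\mathrm{poly}\log n$. There exist a fixed constant $c>0$ and $\epsilon_0=\Theta(1/\log^2(s))$ such that, given $\mathbf{A}\in\mathbb{R}^{n\times n}$ with $\|\mathbf{A}\|_\infty\le 1$, any non-adaptive sampling algorithm which distinguishes with probability at least $3/4$ between the cases (1) $\|\mathbf{A}\|_{\mathrm{KF}(s)}>\frac{c}{\log(s)}n$ and (2) $\|\mathbf{A}\|_{\mathrm{KF}(s)}<(1-\epsilon_0)\frac{c}{\log(s)}n$, must query at least $\tilde{\Omega}(s^2)$ entries of $\mathbf{A}$.
   Context: $\|\mathbf{A}\|_\infty=\max_{i,j}|\mathbf{A}_{i,j}|$. The Ky-Fan $s$ norm is $\|\mathbf{A}\|_{\mathrm{KF}(s)}=\sum_{i=1}^s\sigma_i(\mathbf{A})$, the sum of the $s$ largest singular values. A non-adaptive sampling algorithm fixes its queried entries before seeing any answers. Here $\tilde{\Omega}$ hides polylogarithmic factors in $s$. *)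

theory Defs
  imports
    "Jordan_Normal_Form.Char_Poly"
    "HOL-Computational_Algebra.Polynomial"
    "HOL-Library.FuncSet"
    "HOL-Library.Landau_Symbols"
    "HOL-Probability.Probability_Measure"
begin

definition max_norm :: "real mat \<Rightarrow> real" where
  "max_norm A = Max {\<bar>A $$ (i, j)\<bar> | i j. i < dim_row A \<and> j < dim_col A}"

(* Square roots of the eigenvalues of A^T A, with algebraic multiplicity, in decreasing order. *)
definition singular_values :: "real mat \<Rightarrow> real list" where
  "singular_values A =
     rev (sorted_list_of_multiset (image_mset sqrt (proots (char_poly (A\<^sup>T * A)))))"

definition ky_fan_norm :: "nat \<Rightarrow> real mat \<Rightarrow> real" where
  "ky_fan_norm s A = sum_list (take s (singular_values A))"

(* A deterministic non-adaptive algorithm: the set of queried positions, and a decision based on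
   the entries there. Neither the set nor the decision can depend on anything else in the matrix. *)
type_synonym det_alg = "(nat \<times> nat) set \<times> ((nat \<times> nat \<Rightarrow> real) \<Rightarrow> bool)"

definition run_alg :: "det_alg \<Rightarrow> real mat \<Rightarrow> bool" where
  "run_alg a A = (snd a) (restrict (\<lambda>ij. A $$ ij) (fst a))"

(* A randomized non-adaptive algorithm is a random deterministic one: both the query set and the
   decision rule may depend on the internal coins. Any probability space of coins can be pushed
   forward to this type. The parameter q is a worst-case bound on the number of queries. *)
definition nonadaptive_alg :: "nat \<Rightarrow> nat \<Rightarrow> det_alg measure \<Rightarrow> bool" where
  "nonadaptive_alg n q M \<longleftrightarrow> prob_space M \<and>
     (\<forall>a\<in>space M. fst a \<subseteq> {..<n} \<times> {..<n} \<and> card (fst a) \<le> q)"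

(* The promise problem: output True on P1 and False on P2. A non-measurable event has measure 0
   in HOL, so the inequalities include that the success events are measurable. *)
definition distinguishes ::
  "nat \<Rightarrow> det_alg measure \<Rightarrow> (real mat \<Rightarrow> bool) \<Rightarrow> (real mat \<Rightarrow> bool) \<Rightarrow> bool" where
  "distinguishes n M P1 P2 \<longleftrightarrow>
     (\<forall>A \<in> carrier_mat n n. max_norm A \<le> 1 \<longrightarrow>
        (P1 A \<longrightarrow> measure M {a \<in> space M. run_alg a A} \<ge> 3 / 4) \<and>
        (P2 A \<longrightarrow> measure M {a \<in> space M. \<not> run_alg a A} \<ge> 3 / 4))"

end

(* Idea. The hard instances consist of blocks indexed by b < m, each a signed cyclic l x l matrix
   (sign x_i at (i, i), 1 at (i, i + 1 mod l)); l is even and about log s. Up to diagonal sign changes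
   such a block depends only on the product of its signs, and its singular values are
   2 |cos| of equally spaced angles: the nuclear norm is 2 / sin(pi / 2l) for product -1 and
   2 cot(pi / 2l) for product +1, a relative gap of order 1 / l^2. Every entry is blown up to a
   beta x beta block of equal entries, which multiplies the singular values by beta.

   Each of the l row classes and l column classes is shifted cyclically at random. Then q << m^2
   queries see the whole diagonal of a given block with probability at most (q / m^2)^l, and
   otherwise some sign in every block is invisible, so that flipping it identifies the two cases. *)

theory Submission
  imports Defs "HOL-Analysis.Analysis" "HOL-Real_Asymp.Real_Asymp"
begin

section \<open>Characteristic polynomials and Ky-Fan norms\<close>

text \<open>The rank is at most \<open>m * l \<le> s\<close>, so the Ky-Fan norm of a hard instance
  is its nuclear norm. The length \<open>l\<close> answers two demands: the union bound over
  \<open>m\<close> blocks asks that m (q / m^2)^l be small although q is a constant fraction of m^2,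
  which calls for \<open>l\<close> of order at least log s; a gap of order 1 / log^2 s, and a loss
  of only a logarithm in \<open>m = s div l\<close>, cap \<open>l\<close> at the same order. The
  shifts of different classes are independent, and this independence is what produces the exponent
  \<open>l\<close>. A non-adaptive algorithm commits to its queries without seeing shifts or signs,
  so its success can be averaged over all instances with the coins held fixed.

  With entries of size 1 the norm would be of order n; the factor \<open>t\<close>, of order 1 / log
  s, lowers it to the threshold c n / log s.

  Singular values are given here as roots of a real characteristic polynomial, while cycles are
  diagonalised by complex Fourier vectors. Hence the norm is computed from an explicit complex
  factorisation, which is transferred to the polynomial of \<open>A\<^sup>T * A\<close>.\<close>

lemma char_poly_mult_commute:
  fixes A B :: "'a::idom mat"
  assumes A: "A \<in> carrier_mat n k" and B: "B \<in> carrier_mat k n"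
  shows "[:0, 1:] ^ k * char_poly (A * B) = [:0, 1:] ^ n * char_poly (B * A)"
proof -
  define x :: "'a poly" where "x = [:0, 1:]"
  define A' where "A' = map_mat (\<lambda>a. [:a:]) A"
  define B' where "B' = map_mat (\<lambda>a. [:a:]) B"
  have A': "A' \<in> carrier_mat n k" and B': "B' \<in> carrier_mat k n"
    using A B by (auto simp: A'_def B'_def)
  have cpm: "char_poly_matrix (C * D) = x \<cdot>\<^sub>m 1\<^sub>m r - map_mat (\<lambda>a. [:a:]) C * map_mat (\<lambda>a. [:a:]) D"
    if C: "C \<in> carrier_mat r l" and D: "D \<in> carrier_mat l r" for C D :: "'a mat" and r l
  proof -
    have "map_mat (\<lambda>a. [:a:]) C * map_mat (\<lambda>a. [:a:]) D = map_mat (\<lambda>a. [:a:]) (C * D)"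
      using map_poly_mult(1)[OF C D] by simp
    then show ?thesis
      using C D by (auto simp: char_poly_matrix_def x_def intro!: eq_matI)
  qed
  \<comment> \<open>Sylvester's trick with the block matrix [[x, A], [B, 1]]: \<open>R\<close>
    clears the lower left block from the right and has determinant 1, \<open>L\<close> clears it
    from the left and has determinant \<open>x ^ k\<close>. Comparing the two resulting determinants
    avoids any division by \<open>x\<close>.\<close>
  define M where "M = four_block_mat (x \<cdot>\<^sub>m 1\<^sub>m n) A' B' (1\<^sub>m k)"
  define R where "R = four_block_mat (1\<^sub>m n) (0\<^sub>m n k) (- B') (1\<^sub>m k)"
  define L where "L = four_block_mat (1\<^sub>m n) (0\<^sub>m n k) (- B') (x \<cdot>\<^sub>m 1\<^sub>m k)"
  have M: "M \<in> carrier_mat (n + k) (n + k)" and R: "R \<in> carrier_mat (n + k) (n + k)"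
    and L: "L \<in> carrier_mat (n + k) (n + k)"
    by (auto simp: M_def R_def L_def intro!: four_block_carrier_mat)
  have AB': "A' * B' \<in> carrier_mat n n" and BA': "B' * A' \<in> carrier_mat k k"
    using A' B' by auto
  have detx: "Determinant.det (x \<cdot>\<^sub>m 1\<^sub>m r) = x ^ r" for r
    by simp
  have "M * R = four_block_mat (x \<cdot>\<^sub>m 1\<^sub>m n - A' * B') A' (0\<^sub>m k n) (1\<^sub>m k)"
  proof -
    have 1: "x \<cdot>\<^sub>m 1\<^sub>m n * 1\<^sub>m n + A' * - B' = x \<cdot>\<^sub>m 1\<^sub>m n - A' * B'"
      using A' B' AB' by (simp add: add_uminus_minus_mat[of _ n n])
    have 2: "x \<cdot>\<^sub>m 1\<^sub>m n * 0\<^sub>m n k + A' * 1\<^sub>m k = A'"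
      using A' by simp
    have 3: "B' * 1\<^sub>m n + 1\<^sub>m k * - B' = 0\<^sub>m k n"
      using B' by (simp add: add_uminus_minus_mat[OF B' B'])
    have 4: "B' * 0\<^sub>m n k + 1\<^sub>m k * 1\<^sub>m k = 1\<^sub>m k"
      using B' by simp
    show ?thesis
      unfolding M_def R_def using A' B'
      by (subst mult_four_block_mat[of _ n n _ k _ k]) (simp_all only: 1 2 3 4, auto)
  qed
  then have "Determinant.det (M * R) = Determinant.det (x \<cdot>\<^sub>m 1\<^sub>m n - A' * B') * Determinant.det (1\<^sub>m k)"
    by (simp only: det_four_block_mat_lower_left_zero[OF minus_carrier_mat[OF AB'] A' refl one_carrier_mat])
  also have "\<dots> = char_poly (A * B)"
    by (simp only: char_poly_def cpm[OF A B] det_one mult_1_right A'_def B'_def)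
  finally have MR: "Determinant.det M * Determinant.det R = char_poly (A * B)"
    by (simp only: det_mult[OF M R])
  have "L * M = four_block_mat (x \<cdot>\<^sub>m 1\<^sub>m n) A' (0\<^sub>m k n) (x \<cdot>\<^sub>m 1\<^sub>m k - B' * A')"
  proof -
    have 1: "1\<^sub>m n * (x \<cdot>\<^sub>m 1\<^sub>m n) + 0\<^sub>m n k * B' = x \<cdot>\<^sub>m 1\<^sub>m n"
      using B' by simp
    have 2: "1\<^sub>m n * A' + 0\<^sub>m n k * 1\<^sub>m k = A'"
      using A' by simp
    have "x \<cdot>\<^sub>m (- B') = - (x \<cdot>\<^sub>m B')" by (rule eq_matI) auto
    then have "- B' * (x \<cdot>\<^sub>m 1\<^sub>m n) = - (x \<cdot>\<^sub>m B')"
      using B' by (simp add: mult_smult_distrib[of _ k n _ n])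
    moreover have "x \<cdot>\<^sub>m 1\<^sub>m k * B' = x \<cdot>\<^sub>m B'"
      using B' by (simp add: mult_smult_assoc_mat[of _ k k _ n])
    ultimately have 3: "- B' * (x \<cdot>\<^sub>m 1\<^sub>m n) + x \<cdot>\<^sub>m 1\<^sub>m k * B' = 0\<^sub>m k n"
      using B' by simp
    have 4: "- B' * A' + x \<cdot>\<^sub>m 1\<^sub>m k * 1\<^sub>m k = x \<cdot>\<^sub>m 1\<^sub>m k - B' * A'"
      using A' B' BA' by (simp add: comm_add_mat[of "- (B' * A')" k k] add_uminus_minus_mat[of _ k k])
    show ?thesis
      unfolding M_def L_def using A' B'
      by (subst mult_four_block_mat[of _ n n _ k _ k]) (simp_all only: 1 2 3 4, auto)
  qed
  then have "Determinant.det (L * M)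
      = Determinant.det (x \<cdot>\<^sub>m 1\<^sub>m n) * Determinant.det (x \<cdot>\<^sub>m 1\<^sub>m k - B' * A')"
    by (simp only: det_four_block_mat_lower_left_zero[OF smult_carrier_mat[OF one_carrier_mat] A' refl
          minus_carrier_mat[OF BA']])
  also have "\<dots> = x ^ n * char_poly (B * A)"
    by (simp only: char_poly_def cpm[OF B A] detx A'_def B'_def)
  finally have LM: "Determinant.det L * Determinant.det M = x ^ n * char_poly (B * A)"
    by (simp only: det_mult[OF L M])
  have "Determinant.det R = 1" "Determinant.det L = x ^ k"
    unfolding R_def L_def using B' by (simp_all add: det_four_block_mat_upper_right_zero[of _ n _ k] detx)
  then show ?thesis unfolding x_def[symmetric] using MR LM by (simp only: mult_1_right)
qed

text \<open>The padding zeros sort to the front, hence to the end of the reversed list, so its first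
  \<open>s\<close> entries consist of all of \<open>M\<close> and possibly some zeros.\<close>

lemma sum_list_take_singular:
  fixes M :: "real multiset"
  assumes "\<forall>x\<in>#M. x \<ge> 0" "size M \<le> s"
  shows "sum_list (take s (rev (sorted_list_of_multiset (replicate_mset d 0 + M)))) = sum_mset M"
proof -
  let ?xs = "replicate d 0 @ sorted_list_of_multiset M"
  have "sorted ?xs" using assms(1) by (auto simp: sorted_append)
  moreover have "mset ?xs = replicate_mset d 0 + M" by simp
  ultimately have "sorted_list_of_multiset (replicate_mset d 0 + M) = ?xs"
    by (metis sorted_list_of_multiset_mset sorted_sort_id)
  moreover have "length (sorted_list_of_multiset M) = size M"
    by (metis mset_sorted_list_of_multiset size_mset)
  ultimately show ?thesis using assms(2)
    by (simp add: sum_list_replicate flip: sum_mset_sum_list)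
qed

text \<open>The hypotheses describe a singular value decomposition whose left factor is not
  normalised, so a vanishing \<open>\<sigma> i\<close> is no special case. The Gram matrix is
  \<open>W\<close> times \<open>D\<close> times the adjoint of \<open>W\<close>; moving
  \<open>W\<close> to the right end turns this into \<open>D\<close>, at the price of powers of the
  variable. Injectivity of the embedding of real into complex polynomials leads back to the real
  matrix.\<close>

lemma char_poly_gram_eq:
  fixes A :: "real mat" and U W :: "complex mat" and \<sigma> :: "nat \<Rightarrow> real"
  assumes A: "A \<in> carrier_mat n n" and U: "U \<in> carrier_mat n N" and W: "W \<in> carrier_mat n N"
    and "N \<le> n"
    and AUW: "map_mat of_real A = U * map_mat cnj W\<^sup>T"
    and WW: "map_mat cnj W\<^sup>T * W = 1\<^sub>m N"
    and UU: "map_mat cnj U\<^sup>T * U = Matrix.mat N N (\<lambda>(i, j). if i = j then of_real ((\<sigma> i)\<^sup>2) else 0)"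
  shows "char_poly (A\<^sup>T * A) = [:0, 1:] ^ (n - N) * (\<Prod>i<N. [:- ((\<sigma> i)\<^sup>2), 1:])"
proof -
  interpret of_real_poly: map_poly_inj_comm_ring_hom "of_real :: real \<Rightarrow> complex" ..
  define D :: "complex mat" where "D = Matrix.mat N N (\<lambda>(i, j). if i = j then of_real ((\<sigma> i)\<^sup>2) else 0)"
  define Wh where "Wh = map_mat cnj W\<^sup>T"
  define Uh where "Uh = map_mat cnj U\<^sup>T"
  have carr: "D \<in> carrier_mat N N" "Wh \<in> carrier_mat N n" "Uh \<in> carrier_mat N n"
    using U W by (auto simp: D_def Wh_def Uh_def)
  have "(map_mat of_real A)\<^sup>T = map_mat cnj (map_mat of_real A)\<^sup>T"
    by (auto intro!: eq_matI)
  also have "\<dots> = W * Uh"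
    unfolding AUW using U W
    by (auto intro!: eq_matI sum.cong simp: Uh_def scalar_prod_def mult.commute)
  finally have "map_mat of_real (A\<^sup>T * A) = (W * Uh) * (U * Wh)"
    using A by (simp add: of_real_hom.mat_hom_mult[of _ n n _ n] AUW Wh_def flip: map_mat_transpose)
  also have "\<dots> = W * ((Uh * U) * Wh)"
    using U W carr by (simp add: assoc_mult_mat[of _ n N _ n _ n] assoc_mult_mat[of _ N n _ N _ n])
  also have "Uh * U = D" using UU by (simp add: Uh_def D_def)
  finally have gram: "map_mat of_real (A\<^sup>T * A) = W * (D * Wh)" .
  have "(D * Wh) * W = D"
    using carr W WW by (simp add: assoc_mult_mat[of _ N N _ n _ N] Wh_def)
  moreover have "char_poly D = (\<Prod>i<N. [:- of_real ((\<sigma> i)\<^sup>2), 1:])"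
    by (subst char_poly_upper_triangular[OF carr(1)])
      (auto simp: D_def diag_mat_def prod.list_conv_set_nth atLeast0LessThan intro!: prod.cong)
  ultimately have "[:0, 1:] ^ N * char_poly (map_mat of_real (A\<^sup>T * A))
      = [:0, 1:] ^ n * (\<Prod>i<N. [:- complex_of_real ((\<sigma> i)\<^sup>2), 1:])"
    unfolding gram using char_poly_mult_commute[of W n N "D * Wh"] W carr by auto
  also have "char_poly (map_mat complex_of_real (A\<^sup>T * A)) = map_poly of_real (char_poly (A\<^sup>T * A))"
    using A by (intro of_real_hom.char_poly_hom) auto
  finally have "map_poly complex_of_real ([:0, 1:] ^ N * char_poly (A\<^sup>T * A))
      = map_poly of_real ([:0, 1:] ^ n * (\<Prod>i<N. [:- ((\<sigma> i)\<^sup>2), 1:]))"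
    by (simp add: of_real_poly.hom_mult of_real_poly.hom_power of_real_poly.hom_prod)
  then have "[:0, 1:] ^ N * char_poly (A\<^sup>T * A) = [:0, 1:] ^ n * (\<Prod>i<N. [:- ((\<sigma> i)\<^sup>2), 1:])"
    by (simp only: of_real_poly.eq_iff)
  also have "[:0, 1:] ^ n = [:0, 1 :: real:] ^ N * [:0, 1:] ^ (n - N)"
    using \<open>N \<le> n\<close> by (simp flip: power_add)
  finally show ?thesis by simp
qed

lemma ky_fan_norm_eq_sum:
  fixes A :: "real mat" and U W :: "complex mat" and \<sigma> :: "nat \<Rightarrow> real"
  assumes A: "A \<in> carrier_mat n n" and U: "U \<in> carrier_mat n N" and W: "W \<in> carrier_mat n N"
    and "N \<le> n" "N \<le> s"
    and AUW: "map_mat of_real A = U * map_mat cnj W\<^sup>T"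
    and WW: "map_mat cnj W\<^sup>T * W = 1\<^sub>m N"
    and UU: "map_mat cnj U\<^sup>T * U = Matrix.mat N N (\<lambda>(i, j). if i = j then of_real ((\<sigma> i)\<^sup>2) else 0)"
    and nonneg: "\<And>i. i < N \<Longrightarrow> \<sigma> i \<ge> 0"
  shows "ky_fan_norm s A = (\<Sum>i<N. \<sigma> i)"
proof -
  have "proots (char_poly (A\<^sup>T * A))
      = proots ([:0, 1:] ^ (n - N)) + proots (\<Prod>i<N. [:- ((\<sigma> i)\<^sup>2), 1:])"
    unfolding char_poly_gram_eq[OF assms(1-4) AUW WW UU] by (intro proots_mult) auto
  also have "\<dots> = replicate_mset (n - N) 0 + image_mset (\<lambda>i. (\<sigma> i)\<^sup>2) (mset_set {..<N})"
    by (subst proots_prod) (auto simp: proots_power sum_unfold_sum_mset)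
  finally have "image_mset sqrt (proots (char_poly (A\<^sup>T * A)))
      = replicate_mset (n - N) 0 + image_mset (\<lambda>i. sqrt ((\<sigma> i)\<^sup>2)) (mset_set {..<N})"
    by (simp add: multiset.map_comp o_def)
  also have "image_mset (\<lambda>i. sqrt ((\<sigma> i)\<^sup>2)) (mset_set {..<N}) = image_mset \<sigma> (mset_set {..<N})"
    using nonneg by (intro image_mset_cong) auto
  finally show ?thesis
    unfolding ky_fan_norm_def singular_values_def using nonneg \<open>N \<le> s\<close>
    by (simp add: sum_list_take_singular sum_unfold_sum_mset)
qed

section \<open>Signed cycles\<close>

lemma sum_cis_eq_0:
  fixes e :: int
  assumes "\<not> int l dvd e" "l > 0"
  shows "(\<Sum>j<l. cis (a + real j * (2 * pi * of_int e / real l))) = 0"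
proof -
  define z where "z = cis (2 * pi * of_int e / real l)"
  have "z ^ l = cis (2 * pi * of_int e)"
    using assms(2) by (simp add: z_def Complex.DeMoivre)
  also have "\<dots> = 1" by (rule cis_multiple_2pi) simp
  finally have "z ^ l = 1" .
  moreover have "z \<noteq> 1"
  proof
    assume "z = 1"
    then have "cos (2 * pi * of_int e / real l) = 1"
      by (auto simp: z_def complex_eq_iff)
    then obtain k :: int where "2 * pi * of_int e / real l = of_int k * 2 * pi"
      by (auto simp: cos_one_2pi_int)
    then have "of_int e = (of_int (int l * k) :: real)"
      using assms(2) by (simp add: field_simps)
    then show False using assms(1) unfolding of_int_eq_iff by simp
  qed
  moreover have "(\<Sum>j<l. cis (a + real j * (2 * pi * of_int e / real l))) = cis a * (\<Sum>j<l. z ^ j)"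
    by (simp add: sum_distrib_left z_def Complex.DeMoivre flip: cis_mult)
  ultimately show ?thesis by (simp add: geometric_sum)
qed

text \<open>Half the argument of an \<open>l\<close>-th root of \<open>(-1) ^ d\<close>, for even
  \<open>l\<close>. Subtracting \<open>real l\<close> turns the root by a half circle and, for
  \<open>j < l\<close> and \<open>d \<le> 1\<close>, centres the angles in [-pi/2, pi/2], so that
  the modulus of 1 plus the root is 2 cos of the angle without an absolute value.\<close>

definition cycle_angle :: "nat \<Rightarrow> nat \<Rightarrow> nat \<Rightarrow> real" where
  "cycle_angle l d j = (2 * real j + real d - real l) * pi / (2 * real l)"

definition cycle_root :: "nat \<Rightarrow> nat \<Rightarrow> nat \<Rightarrow> complex" where
  "cycle_root l d j = cis (2 * cycle_angle l d j)"

lemma cycle_root_power: "cycle_root l d j ^ p = cis (real p * (2 * cycle_angle l d j))"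
  by (simp add: cycle_root_def Complex.DeMoivre)

text \<open>The half turn built into the angle contributes \<open>(-1) ^ l\<close>, which is 1 for
  even \<open>l\<close>.\<close>

lemma cycle_root_power_length:
  assumes "even l" "l > 0"
  shows "cycle_root l d j ^ l = (-1) ^ d"
proof -
  obtain h where h: "l = 2 * h" using assms(1) by blast
  have "real l * (2 * cycle_angle l d j) = real d * pi + 2 * pi * of_int (int j - int h)"
    using assms(2) h by (simp add: cycle_angle_def field_simps)
  then show ?thesis
    unfolding cycle_root_power
    by (simp add: cis_multiple_2pi flip: cis_mult) (simp flip: Complex.DeMoivre add: cis_pi)
qed

text \<open>Summation over positions of the cycle: it makes the columns belonging to different
  Fourier modes orthogonal.\<close>

lemma sum_cycle_root_time:
  assumes "j < l" "j' < l"
  shows "(\<Sum>i<l. cnj (cycle_root l d j ^ i) * cycle_root l d j' ^ i) = (if j = j' then of_nat l else 0)"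
proof (cases "j = j'")
  case True
  then show ?thesis by (simp add: cycle_root_power cis_cnj cis_mult)
next
  case False
  define e where "e = int j' - int j"
  have "\<bar>e\<bar> < int l" "e \<noteq> 0" using assms False by (auto simp: e_def)
  then have "\<not> int l dvd e" using zdvd_not_zless[of "\<bar>e\<bar>" "int l"] by auto
  have "cnj (cycle_root l d j ^ i) * cycle_root l d j' ^ i
      = cis (0 + real i * (2 * pi * of_int e / real l))" for i
    using assms(1) unfolding cycle_root_power cis_cnj cis_mult
    by (intro arg_cong[of _ _ cis]) (simp add: e_def cycle_angle_def field_simps)
  then show ?thesis
    using sum_cis_eq_0[OF \<open>\<not> int l dvd e\<close>, of 0] assms(1) False by simp
qed

text \<open>Summation over modes: it recovers the individual matrix entries. Only the difference of
  the exponents is bounded, because the wrap-around of the cycle produces the exponent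
  \<open>l\<close> itself.\<close>

lemma sum_cycle_root_frequency:
  assumes "p \<noteq> q" "p < q + l" "q < p + l"
  shows "(\<Sum>j<l. cycle_root l d j ^ p * cnj (cycle_root l d j ^ q)) = 0"
proof -
  define e where "e = int p - int q"
  have "\<bar>e\<bar> < int l" "e \<noteq> 0" using assms by (auto simp: e_def)
  then have nd: "\<not> int l dvd e" using zdvd_not_zless[of "\<bar>e\<bar>" "int l"] by auto
  have "l > 0" using assms by auto
  then have "cycle_root l d j ^ p * cnj (cycle_root l d j ^ q)
      = cis ((real d - real l) * pi * of_int e / real l + real j * (2 * pi * of_int e / real l))" for j
    unfolding cycle_root_power cis_cnj cis_mult
    by (intro arg_cong[of _ _ cis]) (simp add: e_def cycle_angle_def field_simps)
  then show ?thesis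
    using sum_cis_eq_0[OF nd \<open>l > 0\<close>] by simp
qed

lemma cycle_root_mult_cnj [simp]: "cycle_root l d j ^ p * cnj (cycle_root l d j ^ p) = 1"
  by (simp add: cycle_root_power cis_cnj cis_mult)

text \<open>Half-angle formula. The number 1 plus the root is the eigenvalue of identity plus
  twisted cyclic shift, and its modulus is the singular value.\<close>

lemma norm_one_plus_cycle_root:
  "cnj (1 + cycle_root l d j) * (1 + cycle_root l d j) = of_real ((2 * cos (cycle_angle l d j))\<^sup>2)"
proof -
  have "1 + cycle_root l d j = of_real (2 * cos (cycle_angle l d j)) * cis (cycle_angle l d j)"
    by (auto simp: cycle_root_def complex_eq_iff cos_double_cos sin_double power2_eq_square)
  then show ?thesis
    by (simp add: power2_eq_square cis_cnj cis_mult algebra_simps)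
qed

lemma cos_cycle_angle_nonneg:
  assumes "j < l" "d \<le> 1"
  shows "cos (cycle_angle l d j) \<ge> 0"
proof (rule cos_ge_zero)
  define q where "q = (2 * real j + real d - real l) / real l"
  have "cycle_angle l d j = pi / 2 * q"
    using assms(1) by (simp add: cycle_angle_def q_def)
  moreover have "- 1 \<le> q" "q \<le> 1"
    using assms by (auto simp: q_def field_simps)
  ultimately show "- (pi / 2) \<le> cycle_angle l d j" "cycle_angle l d j \<le> pi / 2"
    using mult_left_mono[of "- 1" q "pi / 2"] mult_left_mono[of q 1 "pi / 2"] by auto
qed

text \<open>Consecutive angles differ by pi / l, so multiplication by twice the sine of half this
  step makes the sum telescope. The values for the two parities differ exactly by the factor cos (pi
  / 2l), the source of the gap.\<close>

lemma sum_cos_cycle_angle: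
  assumes "l > 0" "d \<le> 1"
  shows "(\<Sum>j<l. cos (cycle_angle l d j))
    = (if d = 0 then cos (pi / (2 * real l)) else 1) / sin (pi / (2 * real l))"
proof -
  define y where "y = pi / (2 * real l)"
  define S where "S j = sin ((2 * real j + real d - real l - 1) * y)" for j :: nat
  have "0 < y" "y < pi" using assms(1) pi_gt_zero by (auto simp: y_def field_simps)
  then have "sin y > 0" by (rule sin_gt_zero)
  have ly: "real l * y = pi / 2" using assms(1) by (simp add: y_def)
  have "2 * sin y * (\<Sum>j<l. cos (cycle_angle l d j)) = (\<Sum>j<l. S (Suc j) - S j)"
    unfolding sum_distrib_left
  proof (intro sum.cong refl)
    fix j
    define u where "u = cycle_angle l d j"
    have "S (Suc j) = sin (u + y)" "S j = sin (u - y)"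
      by (simp_all add: S_def u_def cycle_angle_def y_def algebra_simps add_divide_distrib diff_divide_distrib)
    then show "2 * sin y * cos (cycle_angle l d j) = S (Suc j) - S j"
      by (simp add: sin_add sin_diff flip: u_def)
  qed
  also have "\<dots> = S l - S 0" by (rule sum_lessThan_telescope)
  finally have "2 * sin y * (\<Sum>j<l. cos (cycle_angle l d j)) = S l - S 0" .
  moreover have "S l = sin (pi / 2 - (1 - real d) * y)" "S 0 = - sin (pi / 2 + (1 - real d) * y)"
    by (simp_all add: S_def algebra_simps flip: ly sin_minus)
  moreover have "sin (pi / 2 - (1 - real d) * y) - - sin (pi / 2 + (1 - real d) * y)
      = 2 * (if d = 0 then cos y else 1)"
    using assms(2) by (cases d) (auto simp: sin_add sin_diff)
  ultimately have "sin y * (\<Sum>j<l. cos (cycle_angle l d j)) = (if d = 0 then cos y else 1)"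
    by linarith
  then show ?thesis using \<open>sin y > 0\<close>
    unfolding y_def[symmetric] by (simp add: nonzero_eq_divide_eq mult.commute)
qed

lemma sum_div_mod:
  fixes F :: "nat \<Rightarrow> nat \<Rightarrow> 'a::comm_monoid_add"
  shows "(\<Sum>k<m * l. F (k div l) (k mod l)) = (\<Sum>b<m. \<Sum>j<l. F b j)"
proof -
  have "(\<Sum>k\<in>{b * l..<b * l + l}. F (k div l) (k mod l)) = (\<Sum>j<l. F b j)" for b
  proof (rule sum.reindex_bij_witness[of _ "\<lambda>j. b * l + j" "\<lambda>k. k - b * l"])
    fix k assume k: "k \<in> {b * l..<b * l + l}"
    then have "k div l = b" by (intro div_nat_eqI) (auto simp: mult.commute)
    moreover from this have "k mod l = k - b * l"
      using minus_div_mult_eq_mod[of k l] by simp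
    ultimately show "F b (k - b * l) = F (k div l) (k mod l)" by simp
  qed auto
  then show ?thesis by (simp flip: sum.nat_group)
qed

text \<open>The effect of the blow-up: an inner product over rows is \<open>\<beta>\<close> times
  the inner product over cells.\<close>

lemma sum_over_fibres:
  fixes F :: "'b \<Rightarrow> 'a::comm_semiring_1"
  assumes "finite I" "finite G" "\<And>p. p \<in> G \<Longrightarrow> card {r \<in> I. f r = p} = \<beta>"
  shows "(\<Sum>r\<in>I. if f r \<in> G then F (f r) else 0) = of_nat \<beta> * sum F G"
proof -
  have "(\<Sum>r\<in>I. if f r \<in> G then F (f r) else 0) = (\<Sum>r\<in>{r\<in>I. f r \<in> G}. F (f r))"
    using assms(1) by (simp add: sum.inter_filter)
  also have "\<dots> = (\<Sum>p\<in>G. \<Sum>r\<in>{r \<in> {r\<in>I. f r \<in> G}. f r = p}. F (f r))"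
    using assms(1,2) by (intro sum.group[symmetric]) auto
  also have "\<dots> = (\<Sum>p\<in>G. of_nat \<beta> * F p)"
  proof (intro sum.cong refl)
    fix p assume p: "p \<in> G"
    then have "{r \<in> {r\<in>I. f r \<in> G}. f r = p} = {r \<in> I. f r = p}" by auto
    moreover have "(\<Sum>r\<in>{r \<in> I. f r = p}. F (f r)) = (\<Sum>r\<in>{r \<in> I. f r = p}. F p)"
      by (intro sum.cong) auto
    ultimately show "(\<Sum>r\<in>{r \<in> {r\<in>I. f r \<in> G}. f r = p}. F (f r)) = of_nat \<beta> * F p"
      using assms(3)[OF p] by simp
  qed
  finally show ?thesis by (simp add: sum_distrib_left)
qed


section \<open>Nuclear norm of blown-up signed cycles\<close>

definition cycle_entry :: "nat \<Rightarrow> (nat \<times> nat \<Rightarrow> real) \<Rightarrow> nat \<times> nat \<Rightarrow> nat \<times> nat \<Rightarrow> real" where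
  "cycle_entry l x p q = (if fst p = fst q
     then (if snd q = snd p then x p else 0) + (if snd q = Suc (snd p) mod l then 1 else 0) else 0)"

text \<open>The maps \<open>f\<close> and \<open>g\<close> send rows and columns to cells; indices
  sent outside the grid give zero rows and columns. Leaving both maps general lets rows and columns
  be relabelled separately, with only the fibre sizes entering the norm.\<close>

definition cycle_matrix ::
  "nat \<Rightarrow> nat \<Rightarrow> nat \<Rightarrow> (nat \<Rightarrow> nat \<times> nat) \<Rightarrow> (nat \<Rightarrow> nat \<times> nat) \<Rightarrow> (nat \<times> nat \<Rightarrow> real) \<Rightarrow> real \<Rightarrow> real mat"
  where
  "cycle_matrix n m l f g x t = Matrix.mat n n (\<lambda>(r, c).
     if f r \<in> {..<m} \<times> {..<l} \<and> g c \<in> {..<m} \<times> {..<l} then t * cycle_entry l x (f r) (g c) else 0)"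

lemma ky_fan_norm_cycle_matrix:
  fixes x :: "nat \<times> nat \<Rightarrow> real" and f g :: "nat \<Rightarrow> nat \<times> nat"
  assumes l: "even l" "l > 0" and d: "d \<le> 1" and \<beta>: "\<beta> > 0" and t: "t \<ge> 0"
    and f: "\<And>p. p \<in> {..<m} \<times> {..<l} \<Longrightarrow> card {r \<in> {..<n}. f r = p} = \<beta>"
    and g: "\<And>p. p \<in> {..<m} \<times> {..<l} \<Longrightarrow> card {r \<in> {..<n}. g r = p} = \<beta>"
    and x: "\<And>p. p \<in> {..<m} \<times> {..<l} \<Longrightarrow> (x p)\<^sup>2 = 1"
    and prod_x: "\<And>b. b < m \<Longrightarrow> (\<Prod>i<l. x (b, i)) = (-1) ^ d"
    and "m * l \<le> s" "m * l \<le> n"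
  shows "ky_fan_norm s (cycle_matrix n m l f g x t)
    = real m * (2 * t * real \<beta> * (\<Sum>j<l. cos (cycle_angle l d j)))"
proof -
  \<comment> \<open>The partial products \<open>S\<close> gauge the signs away, up to the twist \<open>(-1) ^ d\<close> that the
    roots \<open>\<omega>\<close> absorb; in the twisted Fourier basis \<open>W\<close> the matrix factors as \<open>U\<close> times the adjoint of \<open>W\<close>,
    where the columns of \<open>U\<close> are orthogonal.\<close>
  define N where "N = m * l"
  define G where "G = {..<m} \<times> {..<l}"
  define S :: "nat \<Rightarrow> nat \<Rightarrow> complex" where "S b i = (\<Prod>i'<i. of_real (x (b, i')))" for b i
  define \<omega> where "\<omega> = cycle_root l d"
  \<comment> \<open>A column of \<open>W\<close> has \<open>\<beta> * l\<close> nonzero entries of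
    modulus one before normalisation. The vector \<open>u\<close> is the matrix applied to
    \<open>w\<close>: cell \<open>(b, i)\<close> receives x S_i \<omega>^i + S_{i+1} \<omega>^{i+1}
    = S_{i+1} \<omega>^i (1 + \<omega>), and summing \<open>\<beta>\<close> equal columns gives the
    factor t \<beta> / sqrt (\<beta> l) = t sqrt (\<beta> / l).\<close>
  define w where "w p k = (if fst p = k div l
      then S (fst p) (snd p) * \<omega> (k mod l) ^ snd p / of_real (sqrt (\<beta> * l)) else 0)" for p k
  define u where "u p k = (if fst p = k div l
      then of_real (t * sqrt (\<beta> / l)) * S (fst p) (Suc (snd p)) * \<omega> (k mod l) ^ snd p * (1 + \<omega> (k mod l))
      else 0)" for p k
  define W where "W = Matrix.mat n N (\<lambda>(c, k). if g c \<in> G then w (g c) k else 0)"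
  define U where "U = Matrix.mat n N (\<lambda>(r, k). if f r \<in> G then u (f r) k else 0)"
  define \<sigma> where "\<sigma> k = 2 * t * real \<beta> * cos (cycle_angle l d (k mod l))" for k
  have S_sq: "S b i * S b i = 1" if "b < m" "i \<le> l" for b i
  proof -
    have "S b i * S b i = (\<Prod>i'<i. of_real ((x (b, i'))\<^sup>2))"
      by (simp add: S_def prod.distrib power2_eq_square)
    also have "\<dots> = 1" using that by (intro prod.neutral) (auto simp: x simp del: of_real_power)
    finally show ?thesis .
  qed
  have cnj_S [simp]: "cnj (S b i) = S b i" for b i by (simp add: S_def)
  have S_0: "S b 0 = 1" and S_Suc: "S b (Suc i) = of_real (x (b, i)) * S b i" for b i
    by (simp_all add: S_def mult.commute)
  have S_l: "S b l = (-1) ^ d" if "b < m" for b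
    using arg_cong[OF prod_x[OF that], of complex_of_real] by (simp add: S_def)
  have \<omega>_l: "\<omega> j ^ l = (-1) ^ d" for j
    unfolding \<omega>_def by (rule cycle_root_power_length[OF l])
  have kdiv: "k div l < m" if "k < N" for k
    using that by (simp add: N_def less_mult_imp_div_less)
  have sq1: "complex_of_real (sqrt (\<beta> * l)) * of_real (sqrt (\<beta> * l)) = of_nat \<beta> * of_nat l"
    by (simp flip: of_real_mult) simp
  have sq2: "complex_of_real (sqrt (\<beta> / l)) * of_real (sqrt (\<beta> / l)) = of_nat \<beta> / of_nat l"
    by (simp flip: of_real_mult)
  have sq3: "complex_of_real (sqrt (\<beta> / l)) / of_real (sqrt (\<beta> * l)) = 1 / of_nat l"
  proof -
    have "sqrt (\<beta> / l) / sqrt (\<beta> * l) = 1 / l"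
      using \<beta> l(2) by (simp add: real_sqrt_divide real_sqrt_mult)
    then show ?thesis by (metis of_real_divide of_real_1 of_real_of_nat_eq)
  qed
  have entry: "(\<Sum>k<N. u p k * cnj (w q k)) = of_real (t * cycle_entry l x p q)"
    if p: "p \<in> G" and q: "q \<in> G" for p q
  proof -
    obtain b i b' i' where pq: "p = (b, i)" "q = (b', i')" "b < m" "b' < m" "i < l" "i' < l"
      using p q by (auto simp: G_def)
    show ?thesis
    proof (cases "b = b'")
      case False
      then show ?thesis unfolding w_def u_def pq cycle_entry_def by (auto intro!: sum.neutral)
    next
      case True
      \<comment> \<open>Expanding 1 + \<omega> splits the entry into two Fourier sums:
        \<open>T i\<close> detects the diagonal position, \<open>T (Suc i)\<close> its cyclic
        successor.\<close>
      define T where "T a = (\<Sum>j<l. \<omega> j ^ a * cnj (\<omega> j ^ i'))" for a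
      have "(\<Sum>k<N. u p k * cnj (w q k)) = (\<Sum>b''<m. \<Sum>j<l. if b = b'' then
          of_real t * (complex_of_real (sqrt (\<beta> / l)) / of_real (sqrt (\<beta> * l))) * S b (Suc i) * S b i' *
          (\<omega> j ^ i * cnj (\<omega> j ^ i') + \<omega> j ^ Suc i * cnj (\<omega> j ^ i')) else 0)"
        unfolding N_def sum_div_mod[symmetric]
        by (intro sum.cong refl) (simp add: u_def w_def pq True algebra_simps)
      also have "\<dots> = (\<Sum>b''<m. if b = b'' then of_real t / of_nat l * S b (Suc i) * S b i' * (T i + T (Suc i)) else 0)"
        unfolding sq3 by (intro sum.cong refl) (simp add: T_def sum_distrib_left sum_divide_distrib flip: sum.distrib)
      also have "\<dots> = of_real t / of_nat l * S b (Suc i) * S b i' * (T i + T (Suc i))"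
        using pq by simp
      also have "T i = (if i' = i then of_nat l else 0)"
        using sum_cycle_root_frequency[of i i' l d] pq by (auto simp: T_def \<omega>_def simp del: complex_cnj_power power_Suc)
      also have "T (Suc i) = (if i' = Suc i mod l then of_nat l * S b (Suc i) * S b i' else 0)"
      proof (cases "Suc i < l")
        case True
        then show ?thesis
          using sum_cycle_root_frequency[of "Suc i" i' l d] pq S_sq[of b i'] by (auto simp: T_def \<omega>_def simp del: complex_cnj_power power_Suc)
      next
        case False
        then have "Suc i = l" using pq by auto
        show ?thesis
        \<comment> \<open>At the wrap-around the roots contribute the twist \<open>(-1) ^ d\<close>,
          which agrees with the full product \<open>S b l\<close>; this is why the roots must be
          chosen according to the parity of the signs.\<close>
        proof (cases "i' = 0")
          case True
          then show ?thesis using \<open>Suc i = l\<close> pq by (simp add: T_def \<omega>_l S_l S_0)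
        next
          case False
          then show ?thesis
            using sum_cycle_root_frequency[of "Suc i" i' l d] pq \<open>Suc i = l\<close> by (auto simp: T_def \<omega>_def simp del: complex_cnj_power power_Suc)
        qed
      qed
      also have "of_real t / of_nat l * S b (Suc i) * S b i' * ((if i' = i then of_nat l else 0) +
          (if i' = Suc i mod l then of_nat l * S b (Suc i) * S b i' else 0)) =
          of_real t * ((if i' = i then of_real (x (b, i)) * (S b i * S b i) else 0) +
          (if i' = Suc i mod l then (S b (Suc i) * S b (Suc i)) * (S b i' * S b i') else 0))"
        using l(2) by (simp add: S_Suc field_simps)
      also have "\<dots> = of_real (t * cycle_entry l x p q)"
        using S_sq[of b i] S_sq[of b "Suc i"] S_sq[of b i'] S_sq[of b "Suc i mod l"] pq True
        by (simp add: cycle_entry_def)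
      finally show ?thesis .
    qed
  qed
  \<comment> \<open>Common to \<open>w\<close> and \<open>u\<close>: within a block the product of
    two columns is a factor independent of the position times a product of Fourier modes, so
    orthogonality over positions applies to both.\<close>
  have gram: "(\<Sum>p\<in>G. cnj (h p k) * h p k')
      = (if k = k' then C k k' * of_nat l else 0)"
    if k: "k < N" and k': "k' < N" and
      h: "\<And>b i. b < m \<Longrightarrow> i < l \<Longrightarrow> cnj (h (b, i) k) * h (b, i) k' = (if b = k div l \<and> b = k' div l
        then C k k' * (cnj (\<omega> (k mod l) ^ i) * \<omega> (k' mod l) ^ i) else 0)"
    for h :: "nat \<times> nat \<Rightarrow> nat \<Rightarrow> complex" and C k k'
  proof -
    have "(\<Sum>p\<in>G. cnj (h p k) * h p k') = (\<Sum>b<m. \<Sum>i<l. cnj (h (b, i) k) * h (b, i) k')"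
      by (simp add: G_def sum.cartesian_product)
    also have "\<dots> = (\<Sum>b<m. \<Sum>i<l. if b = k div l \<and> b = k' div l
        then C k k' * (cnj (\<omega> (k mod l) ^ i) * \<omega> (k' mod l) ^ i) else 0)"
      by (intro sum.cong refl) (simp add: h)
    also have "\<dots> = (\<Sum>b<m. if b = k div l then
        (if k div l = k' div l then C k k' * (\<Sum>i<l. cnj (\<omega> (k mod l) ^ i) * \<omega> (k' mod l) ^ i) else 0) else 0)"
      by (intro sum.cong refl) (auto simp: sum_distrib_left)
    also have "\<dots> = (if k div l = k' div l then C k k' * (\<Sum>i<l. cnj (\<omega> (k mod l) ^ i) * \<omega> (k' mod l) ^ i) else 0)"
      using kdiv[OF k] by simp
    also have "\<dots> = (if k div l = k' div l \<and> k mod l = k' mod l then C k k' * of_nat l else 0)"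
      unfolding \<omega>_def using l(2) by (subst sum_cycle_root_time) auto
    also have "(k div l = k' div l \<and> k mod l = k' mod l) = (k = k')"
      by (metis div_mult_mod_eq)
    finally show ?thesis .
  qed
  have w_gram: "of_nat \<beta> * (\<Sum>p\<in>G. cnj (w p k) * w p k') = (if k = k' then 1 else 0)"
    if "k < N" "k' < N" for k k'
  proof -
    have "(\<Sum>p\<in>G. cnj (w p k) * w p k') = (if k = k' then (1 / (of_nat \<beta> * of_nat l)) * of_nat l else 0)"
    proof (rule gram[OF that, of w "\<lambda>_ _. 1 / (of_nat \<beta> * of_nat l)"])
      fix b i assume "b < m" "i < l"
      then show "cnj (w (b, i) k) * w (b, i) k' = (if b = k div l \<and> b = k' div l
          then 1 / (of_nat \<beta> * of_nat l) * (cnj (\<omega> (k mod l) ^ i) * \<omega> (k' mod l) ^ i) else 0)"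
        using S_sq[of b i] by (auto simp: w_def sq1[symmetric] mult.assoc[symmetric])
    qed
    then show ?thesis using \<beta> l(2) by auto
  qed
  have u_gram: "of_nat \<beta> * (\<Sum>p\<in>G. cnj (u p k) * u p k') = (if k = k' then of_real ((\<sigma> k)\<^sup>2) else 0)"
    if "k < N" "k' < N" for k k'
  proof -
    define C where "C k k' = of_real (t * t) * (of_nat \<beta> / of_nat l) * (cnj (1 + \<omega> (k mod l)) * (1 + \<omega> (k' mod l)))" for k k'
    have "(\<Sum>p\<in>G. cnj (u p k) * u p k') = (if k = k' then C k k' * of_nat l else 0)"
    proof (rule gram[OF that])
      fix b i assume "b < m" "i < l"
      show "cnj (u (b, i) k) * u (b, i) k' = (if b = k div l \<and> b = k' div l
          then C k k' * (cnj (\<omega> (k mod l) ^ i) * \<omega> (k' mod l) ^ i) else 0)"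
      proof (cases "b = k div l \<and> b = k' div l")
        case True
        then have "cnj (u (b, i) k) * u (b, i) k' = of_real (t * t) *
            (complex_of_real (sqrt (\<beta> / l)) * of_real (sqrt (\<beta> / l))) * (S b (Suc i) * S b (Suc i)) *
            (cnj (1 + \<omega> (k mod l)) * (1 + \<omega> (k' mod l))) * (cnj (\<omega> (k mod l) ^ i) * \<omega> (k' mod l) ^ i)"
          by (simp add: u_def mult_ac)
        then show ?thesis using True S_sq[of b "Suc i"] \<open>b < m\<close> \<open>i < l\<close> by (simp add: sq2 C_def)
      qed (auto simp: u_def)
    qed
    moreover have "of_nat \<beta> * (C k k * of_nat l) = of_real ((\<sigma> k)\<^sup>2)"
      unfolding C_def \<omega>_def norm_one_plus_cycle_root using l(2)
      by (simp add: \<sigma>_def power2_eq_square)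
    ultimately show ?thesis by auto
  qed
  have carr: "cycle_matrix n m l f g x t \<in> carrier_mat n n" "U \<in> carrier_mat n N" "W \<in> carrier_mat n N"
    by (auto simp: cycle_matrix_def U_def W_def)
  have "finite G" by (simp add: G_def)
  have "ky_fan_norm s (cycle_matrix n m l f g x t) = (\<Sum>k<N. \<sigma> k)"
  proof (rule ky_fan_norm_eq_sum[OF carr])
    show "N \<le> n" "N \<le> s" using assms by (auto simp: N_def)
    show "map_mat of_real (cycle_matrix n m l f g x t) = U * map_mat cnj W\<^sup>T"
    proof (rule eq_matI)
      fix r c assume "r < dim_row (U * map_mat cnj W\<^sup>T)" "c < dim_col (U * map_mat cnj W\<^sup>T)"
      then have rc: "r < n" "c < n" by (auto simp: U_def W_def)
      then have "(U * map_mat cnj W\<^sup>T) $$ (r, c)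
          = (if f r \<in> G \<and> g c \<in> G then \<Sum>k<N. u (f r) k * cnj (w (g c) k) else 0)"
        by (cases "f r \<in> G"; cases "g c \<in> G")
          (simp_all add: U_def W_def scalar_prod_def atLeast0LessThan)
      also have "\<dots> = map_mat of_real (cycle_matrix n m l f g x t) $$ (r, c)"
        using rc entry[of "f r" "g c"] by (simp add: cycle_matrix_def G_def)
      finally show "map_mat of_real (cycle_matrix n m l f g x t) $$ (r, c) = (U * map_mat cnj W\<^sup>T) $$ (r, c)"
        by simp
    qed (auto simp: cycle_matrix_def U_def W_def)
    show "map_mat cnj W\<^sup>T * W = 1\<^sub>m N"
    proof (rule eq_matI)
      fix k k' assume "k < dim_row (1\<^sub>m N)" "k' < dim_col (1\<^sub>m N)"
      then have k: "k < N" "k' < N" by auto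
      then have "(map_mat cnj W\<^sup>T * W) $$ (k, k')
          = (\<Sum>c<n. if g c \<in> G then cnj (w (g c) k) * w (g c) k' else 0)"
        by (auto simp: W_def scalar_prod_def atLeast0LessThan intro!: sum.cong)
      also have "\<dots> = of_nat \<beta> * (\<Sum>p\<in>G. cnj (w p k) * w p k')"
        using g \<open>finite G\<close> by (intro sum_over_fibres) (auto simp: G_def)
      finally show "(map_mat cnj W\<^sup>T * W) $$ (k, k') = 1\<^sub>m N $$ (k, k')"
        using w_gram[OF k] k by simp
    qed (auto simp: W_def)
    show "map_mat cnj U\<^sup>T * U = Matrix.mat N N (\<lambda>(i, j). if i = j then of_real ((\<sigma> i)\<^sup>2) else 0)"
    proof (rule eq_matI)
      fix k k'
      assume "k < dim_row (Matrix.mat N N (\<lambda>(i, j). if i = j then complex_of_real ((\<sigma> i)\<^sup>2) else 0))"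
        "k' < dim_col (Matrix.mat N N (\<lambda>(i, j). if i = j then complex_of_real ((\<sigma> i)\<^sup>2) else 0))"
      then have k: "k < N" "k' < N" by auto
      then have "(map_mat cnj U\<^sup>T * U) $$ (k, k')
          = (\<Sum>c<n. if f c \<in> G then cnj (u (f c) k) * u (f c) k' else 0)"
        by (auto simp: U_def scalar_prod_def atLeast0LessThan intro!: sum.cong)
      also have "\<dots> = of_nat \<beta> * (\<Sum>p\<in>G. cnj (u p k) * u p k')"
        using f \<open>finite G\<close> by (intro sum_over_fibres) (auto simp: G_def)
      finally show "(map_mat cnj U\<^sup>T * U) $$ (k, k')
          = Matrix.mat N N (\<lambda>(i, j). if i = j then complex_of_real ((\<sigma> i)\<^sup>2) else 0) $$ (k, k')"
        using u_gram[OF k] k by simp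
    qed (auto simp: U_def)
    show "0 \<le> \<sigma> k" for k
      using cos_cycle_angle_nonneg[OF mod_less_divisor[OF l(2)] d, of k] t by (simp add: \<sigma>_def)
  qed
  also have "\<dots> = (\<Sum>b<m. \<Sum>j<l. 2 * t * real \<beta> * cos (cycle_angle l d j))"
    unfolding \<sigma>_def N_def by (rule sum_div_mod)
  also have "\<dots> = real m * (2 * t * real \<beta> * (\<Sum>j<l. cos (cycle_angle l d j)))"
    by (simp add: sum_distrib_left)
  finally show ?thesis .
qed

section \<open>Counting queries\<close>

text \<open>Solves a congruence for \<open>a\<close>; \<open>m - u mod m\<close> represents -u
  without truncated subtraction.\<close>

lemma add_mod_eq_iff:
  fixes a b m u :: nat
  assumes "b < m"
  shows "(a + u) mod m = b \<longleftrightarrow> a mod m = (b + (m - u mod m)) mod m"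
proof -
  define a' u' where "a' = a mod m" and "u' = u mod m"
  have "a' < m" "u' < m" using assms by (auto simp: a'_def u'_def)
  moreover have "(a + u) mod m = (a' + u') mod m" by (simp add: a'_def u'_def mod_add_eq)
  ultimately show ?thesis
    using assms unfolding a'_def[symmetric] u'_def[symmetric] by (auto simp: mod_if)
qed

text \<open>Index \<open>r\<close> has residue class \<open>r mod l\<close>, which is shifted cyclically by \<open>u (r mod l)\<close>.
  The pair \<open>(m, l)\<close> lies outside the grid and marks the leftover zero rows and columns.\<close>
definition cell :: "nat \<Rightarrow> nat \<Rightarrow> nat \<Rightarrow> (nat \<Rightarrow> nat) \<Rightarrow> nat \<Rightarrow> nat \<times> nat" where
  "cell m l \<beta> u r = (if r < \<beta> * m * l then ((r div l + u (r mod l)) mod m, r mod l) else (m, l))"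

text \<open>An index has the mixed-radix digits \<open>r mod l\<close> (class),
  \<open>r div l mod m\<close> (block) and \<open>r div l div m\<close> (copy). A shift permutes the
  middle digit within each class, so each cell keeps exactly one index per copy.\<close>

lemma card_cell_fibre:
  assumes "p \<in> {..<m} \<times> {..<l}" "\<beta> * m * l \<le> n"
  shows "card {r \<in> {..<n}. cell m l \<beta> u r = p} = \<beta>"
proof -
  obtain b i where p: "p = (b, i)" "b < m" "i < l" using assms(1) by auto
  define y where "y = (b + (m - u i mod m)) mod m"
  have "y < m" using p by (simp add: y_def)
  have mem: "cell m l \<beta> u r = p \<longleftrightarrow> r < \<beta> * m * l \<and> r mod l = i \<and> r div l mod m = y" for r
    using add_mod_eq_iff[OF \<open>b < m\<close>, of "r div l" "u i"] p by (auto simp: cell_def y_def)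
  have "{r \<in> {..<n}. cell m l \<beta> u r = p} = (\<lambda>e. i + l * (y + m * e)) ` {..<\<beta>}"
  proof (intro equalityI subsetI)
    fix r assume "r \<in> {r \<in> {..<n}. cell m l \<beta> u r = p}"
    then have r: "r < \<beta> * m * l" "r mod l = i" "r div l mod m = y" by (auto simp: mem)
    have "r = i + l * (y + m * (r div l div m))"
      using r(2,3) by (metis mod_mult_div_eq)
    moreover have "r div l div m < \<beta>"
      using r(1) by (simp add: less_mult_imp_div_less)
    ultimately show "r \<in> (\<lambda>e. i + l * (y + m * e)) ` {..<\<beta>}" by blast
  next
    fix r assume "r \<in> (\<lambda>e. i + l * (y + m * e)) ` {..<\<beta>}"
    then obtain e where e: "e < \<beta>" "r = i + l * (y + m * e)" by auto
    then have "r div l = y + m * e" "r mod l = i" using p by auto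
    moreover from this have "r div l mod m = y" "r div l div m = e" using \<open>y < m\<close> by auto
    moreover have "r < \<beta> * m * l"
    proof -
      have "y + m * e < m * \<beta>"
        using \<open>y < m\<close> e(1) mult_le_mono2[of "Suc e" \<beta> m] by simp
      then have "l * Suc (y + m * e) \<le> l * (m * \<beta>)" by (intro mult_le_mono2) simp
      then show ?thesis using e(2) p(3) by (simp add: mult_ac)
    qed
    ultimately show "r \<in> {r \<in> {..<n}. cell m l \<beta> u r = p}" using assms(2) by (auto simp: mem)
  qed
  moreover have "inj_on (\<lambda>e. i + l * (y + m * e)) {..<\<beta>}"
    using p by (auto simp: inj_on_def)
  ultimately show ?thesis by (simp add: card_image)
qed

text \<open>A sign \<open>x p\<close> is written exactly where row and column both lie in cell
  \<open>p\<close>. The pair \<open>w i\<close> packs the row shift and the column shift of class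
  \<open>i\<close>.\<close>

definition queried ::
  "nat \<Rightarrow> nat \<Rightarrow> nat \<Rightarrow> (nat \<times> nat) set \<Rightarrow> (nat \<Rightarrow> nat \<times> nat) \<Rightarrow> nat \<times> nat \<Rightarrow> bool" where
  "queried m l \<beta> Q w p \<longleftrightarrow>
     (\<exists>(r, c)\<in>Q. cell m l \<beta> (fst \<circ> w) r = p \<and> cell m l \<beta> (snd \<circ> w) c = p)"

text \<open>For a fixed block, a query that shows the sign of class \<open>i\<close> determines both
  shifts of that class. Hence each of the \<open>l\<close> pairs has at most \<open>card Q\<close>
  possible values, chosen independently.\<close>

lemma card_fully_queried:
  assumes "finite Q" "b < m"
  shows "card {w \<in> {..<l} \<rightarrow>\<^sub>E {..<m} \<times> {..<m}. \<forall>i<l. queried m l \<beta> Q w (b, i)} \<le> card Q ^ l"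
proof -
  define h where "h = (\<lambda>(r, c). ((b + (m - r div l mod m)) mod m, (b + (m - c div l mod m)) mod m))"
  have "{w \<in> {..<l} \<rightarrow>\<^sub>E {..<m} \<times> {..<m}. \<forall>i<l. queried m l \<beta> Q w (b, i)} \<subseteq> {..<l} \<rightarrow>\<^sub>E h ` Q"
  proof
    fix w assume w: "w \<in> {w \<in> {..<l} \<rightarrow>\<^sub>E {..<m} \<times> {..<m}. \<forall>i<l. queried m l \<beta> Q w (b, i)}"
    have "w i \<in> h ` Q" if "i < l" for i
    proof -
      from w that obtain r c where rc: "(r, c) \<in> Q" "cell m l \<beta> (fst \<circ> w) r = (b, i)"
        "cell m l \<beta> (snd \<circ> w) c = (b, i)" by (auto simp: queried_def)
      have "w i \<in> {..<m} \<times> {..<m}" using w that by auto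
      then have wi: "fst (w i) < m" "snd (w i) < m" by auto
      have "(fst (w i) + r div l) mod m = b" "(snd (w i) + c div l) mod m = b"
        using rc(2,3) assms(2) by (auto simp: cell_def add.commute split: if_splits)
      then have "fst (w i) = fst (h (r, c))" "snd (w i) = snd (h (r, c))"
        using wi by (auto simp: add_mod_eq_iff[OF assms(2)] h_def)
      then have "w i = h (r, c)" by (rule prod_eqI)
      then show ?thesis using rc(1) by auto
    qed
    then show "w \<in> {..<l} \<rightarrow>\<^sub>E h ` Q" using w by (auto simp: PiE_iff)
  qed
  then have "card {w \<in> {..<l} \<rightarrow>\<^sub>E {..<m} \<times> {..<m}. \<forall>i<l. queried m l \<beta> Q w (b, i)}
      \<le> card ({..<l} \<rightarrow>\<^sub>E h ` Q)"
    using assms(1) by (intro card_mono finite_PiE) auto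
  also have "\<dots> = card (h ` Q) ^ l" by (simp add: card_PiE)
  also have "\<dots> \<le> card Q ^ l" using assms(1) by (intro power_mono card_image_le) auto
  finally show ?thesis .
qed

section \<open>Sign patterns with prescribed block products\<close>

definition signs :: "nat \<Rightarrow> nat \<Rightarrow> nat \<Rightarrow> (nat \<times> nat \<Rightarrow> real) set" where
  "signs m l d = {x \<in> {..<m} \<times> {..<l} \<rightarrow>\<^sub>E {1, -1}. \<forall>b<m. (\<Prod>i<l. x (b, i)) = (-1) ^ d}"

definition flip :: "nat \<Rightarrow> (nat \<Rightarrow> nat) \<Rightarrow> (nat \<times> nat \<Rightarrow> real) \<Rightarrow> nat \<times> nat \<Rightarrow> real" where
  "flip m J x p = (if fst p < m \<and> snd p = J (fst p) then - x p else x p)"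

lemma finite_signs: "finite (signs m l d)"
  unfolding signs_def by (rule finite_subset[OF Collect_restrict finite_PiE]) auto

lemma flip_flip [simp]: "flip m J (flip m J x) = x"
  by (auto simp: flip_def)

lemma flip_in_signs:
  assumes "x \<in> signs m l d" "\<And>b. b < m \<Longrightarrow> J b < l"
  shows "flip m J x \<in> signs m l (Suc d)"
proof -
  have "(\<Prod>i<l. flip m J x (b, i)) = (-1) ^ Suc d" if "b < m" for b
  proof -
    have "(\<Prod>i<l. flip m J x (b, i)) = (\<Prod>i<l. (if i = J b then -1 else 1) * x (b, i))"
      using that by (intro prod.cong) (auto simp: flip_def)
    also have "\<dots> = - (\<Prod>i<l. x (b, i))"
      using assms(2)[OF that] by (simp add: prod.distrib)
    finally show ?thesis using assms(1) that by (simp add: signs_def)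
  qed
  moreover have "flip m J x \<in> {..<m} \<times> {..<l} \<rightarrow>\<^sub>E {1, -1}"
  proof (rule PiE_I)
    fix p assume "p \<in> {..<m} \<times> {..<l}"
    then have "x p \<in> {1, -1}" using assms(1) unfolding signs_def by blast
    then show "flip m J x p \<in> {1, -1}" by (auto simp: flip_def)
  next
    fix p assume p: "p \<notin> {..<m} \<times> {..<l}"
    then have "x p = undefined" using assms(1) unfolding signs_def by (blast intro: PiE_arb)
    then show "flip m J x p = undefined" using p assms(2)[of "fst p"] by (cases p) (auto simp: flip_def)
  qed
  ultimately show ?thesis by (simp add: signs_def)
qed

lemma signs_add_2: "signs m l (Suc (Suc d)) = signs m l d"
  by (simp add: signs_def)

lemma bij_betw_flip:
  assumes "\<And>b. b < m \<Longrightarrow> J b < l"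
  shows "bij_betw (flip m J) (signs m l 0) (signs m l 1)"
  using flip_in_signs[OF _ assms, where d = 0] flip_in_signs[OF _ assms, where d = 1] signs_add_2[of m l 0]
  by (intro bij_betw_byWitness[of _ "flip m J"]) (auto simp: numeral_2_eq_2)

lemma card_signs:
  assumes "l > 0"
  shows "card (signs m l 1) = card (signs m l 0)" "card (signs m l 0) > 0"
proof -
  show "card (signs m l 1) = card (signs m l 0)"
    using bij_betw_same_card[OF bij_betw_flip[of m "\<lambda>_. 0" l]] assms by simp
  have "restrict (\<lambda>_. 1) ({..<m} \<times> {..<l}) \<in> signs m l 0"
    by (auto simp: signs_def intro!: prod.neutral)
  then show "card (signs m l 0) > 0" using finite_signs card_gt_0_iff by blast
qed

definition hard_matrix ::
  "nat \<Rightarrow> nat \<Rightarrow> nat \<Rightarrow> nat \<Rightarrow> real \<Rightarrow> (nat \<Rightarrow> nat \<times> nat) \<Rightarrow> (nat \<times> nat \<Rightarrow> real) \<Rightarrow> real mat" where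
  "hard_matrix n m l \<beta> t w x =
     cycle_matrix n m l (cell m l \<beta> (fst \<circ> w)) (cell m l \<beta> (snd \<circ> w)) x t"

text \<open>A sign influences only entries whose row and column lie in its own cell, and no such
  entry of a flipped cell is queried. The algorithm therefore receives identical answers on both
  matrices.\<close>

lemma run_alg_flip:
  assumes "fst a \<subseteq> {..<n} \<times> {..<n}" "\<And>b. b < m \<Longrightarrow> \<not> queried m l \<beta> (fst a) w (b, J b)"
  shows "run_alg a (hard_matrix n m l \<beta> t w (flip m J x)) = run_alg a (hard_matrix n m l \<beta> t w x)"
proof -
  let ?f = "cell m l \<beta> (fst \<circ> w)" and ?g = "cell m l \<beta> (snd \<circ> w)"
  have "restrict (\<lambda>ij. hard_matrix n m l \<beta> t w (flip m J x) $$ ij) (fst a)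
      = restrict (\<lambda>ij. hard_matrix n m l \<beta> t w x $$ ij) (fst a)"
  proof (rule restrict_ext)
    fix ij assume ij: "ij \<in> fst a"
    then obtain r c where rc: "ij = (r, c)" "r < n" "c < n" using assms(1) by auto
    have "cycle_entry l (flip m J x) (?f r) (?g c) = cycle_entry l x (?f r) (?g c)"
    proof (cases "?f r = ?g c")
      case True
      then have "queried m l \<beta> (fst a) w (?f r)" using ij rc by (auto simp: queried_def)
      then have "flip m J x (?f r) = x (?f r)"
        using assms(2)[of "fst (?f r)"] by (auto simp: flip_def) (metis prod.collapse)
      then show ?thesis by (simp add: cycle_entry_def)
    qed (auto simp: cycle_entry_def prod_eq_iff)
    then show "hard_matrix n m l \<beta> t w (flip m J x) $$ ij = hard_matrix n m l \<beta> t w x $$ ij"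
      using rc by (simp add: hard_matrix_def cycle_matrix_def)
  qed
  then show ?thesis by (simp add: run_alg_def)
qed

section \<open>Averaging over the hard instances\<close>

lemma (in prob_space) sum_success_le:
  fixes E :: "'i \<Rightarrow> 'a set"
  assumes "finite I" "\<And>i. i \<in> I \<Longrightarrow> p \<le> measure M (E i)" "0 < p"
    and "\<And>a. a \<in> space M \<Longrightarrow> (\<Sum>i\<in>I. indicator (E i) a) \<le> B"
  shows "p * real (card I) \<le> B"
proof -
  \<comment> \<open>A non-measurable set has measure 0, so the positive lower bound \<open>p\<close>
    forces measurability.\<close>
  have E: "E i \<in> sets M" if "i \<in> I" for i
    using assms(2)[OF that] assms(3) measure_notin_sets[of "E i" M] by fastforce
  have int: "integrable M (indicat_real (E i))" if "i \<in> I" for i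
    using E[OF that] by (intro integrable_real_indicator) (auto simp: emeasure_eq_measure)
  have "p * real (card I) \<le> (\<Sum>i\<in>I. measure M (E i))"
    using sum_mono[of I "\<lambda>_. p" "\<lambda>i. measure M (E i)"] assms(2) by (simp add: mult.commute)
  also have "\<dots> = (\<integral>a. (\<Sum>i\<in>I. indicator (E i) a) \<partial>M)"
    using E int by (subst Bochner_Integration.integral_sum) auto
  also have "\<dots> \<le> (\<integral>a. B \<partial>M)"
    using int assms(4) by (intro integral_mono Bochner_Integration.integrable_sum) auto
  also have "\<dots> = B" by (simp add: prob_space)
  finally show ?thesis .
qed

text \<open>Yao's averaging argument. For fixed coins and a shift that exposes no complete block
  diagonal, a pattern and its flip get the same answer although opposite ones are required, so
  exactly half of the \<open>2 * Y\<close> patterns succeed; for the other shifts success is bounded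
  trivially. An average success of 3/4 thus requires that at least half of the shifts be bad for
  some coins, and a union bound over the blocks limits their number to
  \<open>m * q ^ l\<close>.\<close>

lemma query_lower_bound:
  assumes alg: "nonadaptive_alg n q M" and l: "l > 0" and m: "m > 0"
    and yes: "\<And>w x. w \<in> {..<l} \<rightarrow>\<^sub>E {..<m} \<times> {..<m} \<Longrightarrow> x \<in> signs m l 1 \<Longrightarrow>
      measure M {a \<in> space M. run_alg a (hard_matrix n m l \<beta> t w x)} \<ge> 3 / 4"
    and no: "\<And>w x. w \<in> {..<l} \<rightarrow>\<^sub>E {..<m} \<times> {..<m} \<Longrightarrow> x \<in> signs m l 0 \<Longrightarrow>
      measure M {a \<in> space M. \<not> run_alg a (hard_matrix n m l \<beta> t w x)} \<ge> 3 / 4"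
  shows "real ((m * m) ^ l) \<le> 2 * real m * real q ^ l"
proof -
  interpret prob_space M using alg by (simp add: nonadaptive_alg_def)
  define Ws where "Ws = ({..<l} \<rightarrow>\<^sub>E {..<m} \<times> {..<m})"
  define X where "X = signs m l"
  define Y where "Y = real (card (X 0))"
  define A where "A = hard_matrix n m l \<beta> t"
  define E where "E = (\<lambda>(w, x). {a \<in> space M. run_alg a (A w x) = (x \<in> X 1)})"
  have [simp]: "finite Ws" "finite (X d)" for d by (auto simp: Ws_def X_def finite_signs intro: finite_PiE)
  have disj: "X 0 \<inter> X 1 = {}"
    using m by (auto simp: X_def signs_def)
  have card_X: "card (X 1) = card (X 0)" "Y > 0"
    using card_signs[OF l] by (auto simp: X_def Y_def)
  define bad where "bad Q w \<longleftrightarrow> (\<exists>b<m. \<forall>i<l. queried m l \<beta> Q w (b, i))" for Q w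
  have card_bad: "real (card {w \<in> Ws. bad (fst a) w}) \<le> real m * real q ^ l" if a: "a \<in> space M" for a
  proof -
    have fin: "finite (fst a)" and q: "card (fst a) \<le> q"
      using alg a by (auto simp: nonadaptive_alg_def intro: finite_subset[of _ "{..<n} \<times> {..<n}"])
    have "{w \<in> Ws. bad (fst a) w}
        = (\<Union>b<m. {w \<in> {..<l} \<rightarrow>\<^sub>E {..<m} \<times> {..<m}. \<forall>i<l. queried m l \<beta> (fst a) w (b, i)})"
      by (auto simp: bad_def Ws_def)
    then have "card {w \<in> Ws. bad (fst a) w}
        \<le> (\<Sum>b<m. card {w \<in> {..<l} \<rightarrow>\<^sub>E {..<m} \<times> {..<m}. \<forall>i<l. queried m l \<beta> (fst a) w (b, i)})"
      by (simp add: card_UN_le)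
    also have "\<dots> \<le> (\<Sum>b<m. card (fst a) ^ l)"
      by (intro sum_mono card_fully_queried fin) auto
    also have "\<dots> \<le> m * q ^ l" using q by (simp add: power_mono)
    finally show ?thesis by (metis of_nat_le_iff of_nat_mult of_nat_power)
  qed
  have success: "(\<Sum>x\<in>X 0 \<union> X 1. indicator (E (w, x)) a) \<le> Y * (1 + (if bad (fst a) w then 1 else 0))"
    if a: "a \<in> space M" and w: "w \<in> Ws" for a w
  proof (cases "bad (fst a) w")
    case True
    have "(\<Sum>x\<in>X 0 \<union> X 1. indicator (E (w, x)) a) \<le> (\<Sum>x\<in>X 0 \<union> X 1. 1 :: real)"
      by (intro sum_mono) (auto simp: indicator_def)
    also have "\<dots> = Y * 2"
      using disj card_X by (simp add: card_Un_disjoint Y_def)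
    finally show ?thesis using True by simp
  next
    case False
    then have "\<forall>b. \<exists>i. b < m \<longrightarrow> i < l \<and> \<not> queried m l \<beta> (fst a) w (b, i)"
      by (auto simp: bad_def)
    \<comment> \<open>The hidden positions depend on the query set and on the shifts but not on the
      signs, so one and the same flip matches the two cases bijectively. Non-adaptivity enters
      here.\<close>
    then obtain J where J: "\<And>b. b < m \<Longrightarrow> J b < l" "\<And>b. b < m \<Longrightarrow> \<not> queried m l \<beta> (fst a) w (b, J b)"
      by metis
    have sub: "fst a \<subseteq> {..<n} \<times> {..<n}" using alg a by (auto simp: nonadaptive_alg_def)
    have "(\<Sum>x\<in>X 1. indicator (E (w, x)) a) = (\<Sum>x\<in>X 0. indicator (E (w, flip m J x)) a :: real)"
      using bij_betw_flip[of m J l] J(1) unfolding X_def by (intro sum.reindex_bij_betw[symmetric]) auto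
    also have "\<dots> = (\<Sum>x\<in>X 0. if run_alg a (A w x) then 1 else 0)"
    proof (intro sum.cong refl)
      fix x assume "x \<in> X 0"
      then have "flip m J x \<in> X 1" using flip_in_signs[of x m l 0 J] J(1) by (simp add: X_def)
      then show "indicator (E (w, flip m J x)) a = (if run_alg a (A w x) then 1 else 0 :: real)"
        using a run_alg_flip[OF sub J(2), of t x] by (simp add: E_def A_def indicator_def)
    qed
    finally have "(\<Sum>x\<in>X 1. indicator (E (w, x)) a) = (\<Sum>x\<in>X 0. if run_alg a (A w x) then 1 else 0 :: real)" .
    moreover have "(\<Sum>x\<in>X 0. indicator (E (w, x)) a) = (\<Sum>x\<in>X 0. if run_alg a (A w x) then 0 else 1 :: real)"
      using a disj by (intro sum.cong) (auto simp: E_def indicator_def)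
    ultimately have "(\<Sum>x\<in>X 0 \<union> X 1. indicator (E (w, x)) a) = (\<Sum>x\<in>X 0.
        (if run_alg a (A w x) then 0 else 1) + (if run_alg a (A w x) then 1 else 0 :: real))"
      using disj by (simp only: sum.distrib) (simp add: sum.union_disjoint)
    also have "\<dots> = (\<Sum>x\<in>X 0. 1)" by (intro sum.cong) auto
    finally show ?thesis using False by (simp add: Y_def)
  qed
  have "3 / 4 * real (card (Ws \<times> (X 0 \<union> X 1))) \<le> Y * (real (card Ws) + real m * real q ^ l)"
  proof (rule sum_success_le[where E = E])
    fix i assume "i \<in> Ws \<times> (X 0 \<union> X 1)"
    then obtain w x where i: "i = (w, x)" "w \<in> Ws" "x \<in> X 0 \<union> X 1" by auto
    show "3 / 4 \<le> measure M (E i)"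
    proof (cases "x \<in> X 1")
      case True
      then show ?thesis using yes[of w x] i by (simp add: E_def A_def Ws_def X_def)
    next
      case False
      then show ?thesis using no[of w x] i by (simp add: E_def A_def Ws_def X_def)
    qed
  next
    fix a assume a: "a \<in> space M"
    have "(\<Sum>i\<in>Ws \<times> (X 0 \<union> X 1). indicator (E i) a)
        = (\<Sum>w\<in>Ws. \<Sum>x\<in>X 0 \<union> X 1. indicator (E (w, x)) a :: real)"
      by (simp add: sum.cartesian_product)
    also have "\<dots> \<le> (\<Sum>w\<in>Ws. Y * (1 + (if bad (fst a) w then 1 else 0)))"
      using success[OF a] by (intro sum_mono)
    also have "\<dots> = Y * (real (card Ws) + real (card {w \<in> Ws. bad (fst a) w}))"
      by (simp add: sum.distrib Int_def flip: sum_distrib_left sum.inter_filter)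
    also have "\<dots> \<le> Y * (real (card Ws) + real m * real q ^ l)"
      using card_bad[OF a] card_X by simp
    finally show "(\<Sum>i\<in>Ws \<times> (X 0 \<union> X 1). indicator (E i) a) \<le> Y * (real (card Ws) + real m * real q ^ l)" .
  qed auto
  also have "real (card (Ws \<times> (X 0 \<union> X 1))) = real (card Ws) * (2 * Y)"
    using disj card_X by (simp add: card_cartesian_product card_Un_disjoint Y_def)
  finally have "Y * (3 / 2 * real (card Ws)) \<le> Y * (real (card Ws) + real m * real q ^ l)" by simp
  then have "3 / 2 * real (card Ws) \<le> real (card Ws) + real m * real q ^ l"
    using card_X(2) by simp
  moreover have "card Ws = (m * m) ^ l" by (simp add: Ws_def card_PiE)
  ultimately show ?thesis by simp
qed

section \<open>Parameters\<close>

lemma max_norm_cycle_matrix_le_1: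
  assumes "n > 0" "l > 1" "0 \<le> t" "t \<le> 1"
    and x: "\<And>p. p \<in> {..<m} \<times> {..<l} \<Longrightarrow> \<bar>x p\<bar> \<le> 1"
  shows "max_norm (cycle_matrix n m l f g x t) \<le> 1"
proof -
  have "\<bar>cycle_matrix n m l f g x t $$ (i, j)\<bar> \<le> 1" if "i < n" "j < n" for i j
  proof (cases "f i \<in> {..<m} \<times> {..<l} \<and> g j \<in> {..<m} \<times> {..<l}")
    case True
    \<comment> \<open>For \<open>l > 1\<close> the sign and the constant 1 never fall on the same
      position, so they are not added.\<close>
    have "Suc k mod l \<noteq> k" if "k < l" for k
      using that assms(2) by (cases "Suc k = l") auto
    then have "\<bar>cycle_entry l x (f i) (g j)\<bar> \<le> 1"
      using True x[of "f i"] by (force simp: cycle_entry_def)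
    then have "\<bar>t * cycle_entry l x (f i) (g j)\<bar> \<le> 1"
      using assms(3,4) by (auto simp: abs_mult intro!: mult_le_one)
    then show ?thesis using that by (simp add: cycle_matrix_def)
  next
    case False
    then show ?thesis using that by (auto simp: cycle_matrix_def)
  qed
  moreover have "dim_row (cycle_matrix n m l f g x t) = n" "dim_col (cycle_matrix n m l f g x t) = n"
    by (simp_all add: cycle_matrix_def)
  moreover have "finite {\<bar>cycle_matrix n m l f g x t $$ (i, j)\<bar> |i j. i < n \<and> j < n}"
    by (rule finite_image_set2) auto
  ultimately show ?thesis
    unfolding max_norm_def using \<open>n > 0\<close> by (subst Max_le_iff) auto
qed

lemma hard_matrix_in_promise:
  assumes "even l" "l > 0" "m * l > 0" "\<beta> > 0" "\<beta> * (m * l) \<le> n" "m * l \<le> s" "0 \<le> t" "t \<le> 1"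
    and "d \<le> 1" "x \<in> signs m l d"
  shows "hard_matrix n m l \<beta> t w x \<in> carrier_mat n n"
    and "max_norm (hard_matrix n m l \<beta> t w x) \<le> 1"
    and "ky_fan_norm s (hard_matrix n m l \<beta> t w x) = 2 * t * real \<beta> * real m *
      ((if d = 0 then cos (pi / (2 * real l)) else 1) / sin (pi / (2 * real l)))"
proof -
  show "hard_matrix n m l \<beta> t w x \<in> carrier_mat n n"
    by (simp add: hard_matrix_def cycle_matrix_def)
  have x: "x p = 1 \<or> x p = -1" if "p \<in> {..<m} \<times> {..<l}" for p
    using assms(10) that unfolding signs_def by blast
  have "m * l \<le> \<beta> * (m * l)" using assms(4) by simp
  then have "m * l \<le> n" using assms(5) by linarith
  then have "n > 0" using assms(3) by linarith
  have "l > 1" using assms(1,2) by (cases "l = 1") auto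
  show "max_norm (hard_matrix n m l \<beta> t w x) \<le> 1"
    unfolding hard_matrix_def using x \<open>n > 0\<close> \<open>l > 1\<close> assms(7,8)
    by (intro max_norm_cycle_matrix_le_1) fastforce+
  show "ky_fan_norm s (hard_matrix n m l \<beta> t w x) = 2 * t * real \<beta> * real m *
      ((if d = 0 then cos (pi / (2 * real l)) else 1) / sin (pi / (2 * real l)))"
    unfolding hard_matrix_def
  proof (subst ky_fan_norm_cycle_matrix[where \<beta> = \<beta> and d = d])
    have "\<beta> * m * l \<le> n" using assms(5) by (simp add: mult.assoc)
    then show "card {r \<in> {..<n}. cell m l \<beta> (fst \<circ> w) r = p} = \<beta>"
      "card {r \<in> {..<n}. cell m l \<beta> (snd \<circ> w) r = p} = \<beta>" if "p \<in> {..<m} \<times> {..<l}" for p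
      using that by (simp_all only: card_cell_fibre)
    show "(x p)\<^sup>2 = 1" if "p \<in> {..<m} \<times> {..<l}" for p using x[OF that] by auto
    show "(\<Prod>i<l. x (b, i)) = (-1) ^ d" if "b < m" for b
      using assms(10) that by (simp add: signs_def)
    show "real m * (2 * t * real \<beta> * (\<Sum>j<l. cos (cycle_angle l d j))) = 2 * t * real \<beta> * real m *
      ((if d = 0 then cos (pi / (2 * real l)) else 1) / sin (pi / (2 * real l)))"
      unfolding sum_cos_cycle_angle[OF assms(2,9)] by simp
  qed (use assms \<open>m * l \<le> n\<close> in auto)
qed


text \<open>Since cos y = 1 - 2 sin^2 (y / 2), it suffices that sin (y / 2) \<ge> y / 4, which the
  mean value theorem gives because the cosine is at least 1/2 up to pi / 3.\<close>

lemma cos_le_one_minus: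
  fixes y :: real
  assumes "0 \<le> y" "y \<le> pi / 2"
  shows "cos y \<le> 1 - y\<^sup>2 / 8"
proof -
  have "y / 2 * (1 / 2) \<le> sin (y / 2)"
  proof (cases "y = 0")
    case False
    then obtain z where z: "0 < z" "z < y / 2" "sin (y / 2) - sin 0 = (y / 2 - 0) * cos z"
      using MVT2[of 0 "y / 2" sin cos] assms by (auto intro: derivative_eq_intros)
    have "cos (pi / 3) \<le> cos z" using z assms by (intro cos_monotone_0_pi_le) auto
    then have "1 / 2 \<le> cos z" by (simp add: cos_60)
    then have "y / 2 * (1 / 2) \<le> y / 2 * cos z" using assms by (intro mult_left_mono) auto
    also have "\<dots> = sin (y / 2)" using z(3) by simp
    finally show ?thesis .
  qed simp
  then have "(y / 2 * (1 / 2))\<^sup>2 \<le> (sin (y / 2))\<^sup>2" using assms by (intro power_mono) auto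
  then show ?thesis using cos_double_sin[of "y / 2"] by (simp add: power2_eq_square)
qed

text \<open>An even number between ln s / 2 and ln s / 2 + 2. The lower bound yields e^(4l) \<ge>
  s^2, enough to beat the union bound; the upper bound controls the gap and the number of
  blocks.\<close>

definition cycle_length :: "nat \<Rightarrow> nat" where
  "cycle_length s = 2 * (nat \<lfloor>ln (real s) / 4\<rfloor> + 1)"

lemma cycle_length:
  assumes "s \<ge> 2"
  shows "even (cycle_length s)" "cycle_length s \<ge> 2" "ln (real s) / 2 \<le> real (cycle_length s)"
    "real (cycle_length s) \<le> ln (real s) / 2 + 2" "cycle_length s \<le> s"
proof -
  have pos: "ln (real s) \<ge> 0" using assms by simp
  show "even (cycle_length s)" "cycle_length s \<ge> 2" by (auto simp: cycle_length_def)
  define z where "z = ln (real s) / 4"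
  have ln_eq: "ln (real s) = 4 * z" by (simp add: z_def)
  define F where "F = real_of_int \<lfloor>z\<rfloor>"
  have F: "F \<le> z" "z \<le> F + 1" by (simp_all add: F_def)
  have eq: "real (cycle_length s) = 2 * (F + 1)"
    using pos by (simp add: cycle_length_def z_def F_def)
  show "ln (real s) / 2 \<le> real (cycle_length s)"
    unfolding eq ln_eq using F by simp
  show *: "real (cycle_length s) \<le> ln (real s) / 2 + 2"
    unfolding eq ln_eq using F by simp
  show "cycle_length s \<le> s"
  \<comment> \<open>The estimate ln s \<le> s - 1 suffices only from s = 3 on; for s = 2 the length
    is computed to be 2.\<close>
  proof (cases "s = 2")
    case True
    have "ln (2 :: real) < 1" using ln_2_less_1 .
    then have "\<lfloor>ln (real 2) / 4\<rfloor> = 0" using ln_ge_zero[of "2 :: real"] by (simp add: floor_eq_iff)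
    then show ?thesis using True by (simp add: cycle_length_def)
  next
    case False
    then have "real s \<ge> 3" using assms by simp
    moreover have "ln (real s) \<le> real s - 1" using assms by (intro ln_le_minus_one) auto
    ultimately have "real (cycle_length s) \<le> real s" using * by linarith
    then show ?thesis by simp
  qed
qed

text \<open>The constant is 5184 = 64 * 81. From s < 2 l m and l \<le> 4 L follows s \<le> 8 L m, so
  a smaller \<open>q\<close> would be at most m^2 / 81, and the inequality would give 81^l \<le> 2 m
  \<le> s. But 81 = 3^4 \<ge> e^4 gives 81^l \<ge> s^2, a contradiction for s \<ge> 2.\<close>

lemma queries_ge_of_power_bound:
  assumes s: "s \<ge> 2" and l: "l = cycle_length s" and m: "m = s div l"
    and ineq: "real ((m * m) ^ l) \<le> 2 * real m * real q ^ l"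
  shows "real q \<ge> 1 / 5184 * (real s)\<^sup>2 / (ln (real s))\<^sup>2"
proof (rule ccontr)
  define L where "L = ln (real s)"
  assume "\<not> ?thesis"
  then have q: "real q < 1 / 5184 * (real s)\<^sup>2 / L\<^sup>2" by (simp add: L_def)
  note len = cycle_length[OF s, folded l L_def]
  have "ln 2 \<le> L" using s by (simp add: L_def)
  then have L: "2 / 3 \<le> L" using ln2_ge_two_thirds by linarith
  have "m \<ge> 1" using len s by (simp add: m div_greater_zero_iff Suc_le_eq)
  have "s < l * Suc m" using len by (simp add: m dividend_less_times_div)
  also have "\<dots> \<le> 2 * l * m" using \<open>m \<ge> 1\<close> by simp
  finally have "real s \<le> real (2 * l * m)" by (simp only: of_nat_le_iff)
  also have "\<dots> = 2 * real l * real m" by simp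
  also have "\<dots> \<le> 2 * (4 * L) * real m" using len(4) L by (intro mult_right_mono mult_left_mono) auto
  finally have "real s \<le> 8 * L * real m" by simp
  then have "(real s)\<^sup>2 \<le> (8 * L * real m)\<^sup>2" by (intro power_mono) auto
  then have "(real s)\<^sup>2 / L\<^sup>2 \<le> 64 * (real m)\<^sup>2" using L by (simp add: field_simps power_mult_distrib)
  then have "real q \<le> (real m)\<^sup>2 / 81" using q by simp
  then have "real q ^ l \<le> ((real m)\<^sup>2 / 81) ^ l" by (intro power_mono) auto
  also have "\<dots> = real ((m * m) ^ l) / 81 ^ l" by (simp add: power_divide power2_eq_square)
  finally have "real ((m * m) ^ l) \<le> 2 * real m * (real ((m * m) ^ l) / 81 ^ l)"
    using ineq mult_left_mono[of "real q ^ l" _ "2 * real m"] by fastforce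
  then have "real ((m * m) ^ l) * 81 ^ l \<le> real ((m * m) ^ l) * (2 * real m)"
    by (simp add: field_simps)
  moreover have "real ((m * m) ^ l) > 0" using \<open>m \<ge> 1\<close> by simp
  ultimately have le: "81 ^ l \<le> 2 * real m" using mult_le_cancel_left_pos by blast
  have "real s * real s = exp (2 * L)" using s by (simp add: L_def exp_double power2_eq_square)
  also have "\<dots> \<le> exp (real l * 4)" using len(3) by simp
  also have "\<dots> = (exp 1 ^ 4) ^ l" using exp_of_nat_mult[of 4 "1 :: real"] exp_of_nat_mult[of l "4 :: real"] by simp
  also have "\<dots> \<le> (3 ^ 4) ^ l" by (intro power_mono exp_le) auto
  also have "\<dots> \<le> 2 * real m" using le by simp
  also have "\<dots> \<le> real s"
  proof -
    have "2 * m \<le> l * m" using len by simp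
    also have "\<dots> \<le> s" by (simp add: m)
    finally have "real (2 * m) \<le> real s" by (simp only: of_nat_le_iff)
    then show ?thesis by simp
  qed
  finally have "real s * real s \<le> real s * 1" by simp
  then show False using s by simp
qed

theorem mainTheorem6:
  "\<exists>(c :: real) (eps0 :: nat \<Rightarrow> real) (K :: real) (p :: nat) (C :: real) (k :: nat).
     c > 0 \<and> K > 0 \<and> C > 0 \<and>
     eps0 \<in> \<Theta>(\<lambda>s. 1 / (ln (real s))\<^sup>2) \<and> (\<forall>s. 0 < eps0 s \<and> eps0 s < 1) \<and>
     (\<forall>(n :: nat) (s :: nat) (q :: nat) (M :: det_alg measure).
        1 \<le> s \<longrightarrow> real s \<le> real n / (K * ln (real n) ^ p) \<longrightarrow>
        nonadaptive_alg n q M \<longrightarrow>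
        distinguishes n M
          (\<lambda>A. ky_fan_norm s A > c / ln (real s) * real n)
          (\<lambda>A. ky_fan_norm s A < (1 - eps0 s) * (c / ln (real s)) * real n) \<longrightarrow>
        real q \<ge> C * (real s)\<^sup>2 / ln (real s) ^ k)"
proof -
  \<comment> \<open>The summand 4 comes from 2 l \<le> ln s + 4, which yields 2 \<epsilon> \<le> 1 /
    (8 l^2) \<le> y^2 / 8 for y = pi / 2l. It also keeps the value positive and below 1 at s = 0 and
    s = 1, where \<open>ln (real s)\<close> is 0.\<close>
  define eps0 where "eps0 s = 1 / (4 * (ln (real s) + 4)\<^sup>2)" for s :: nat
  have theta: "eps0 \<in> \<Theta>(\<lambda>s. 1 / (ln (real s))\<^sup>2)"
    unfolding eps0_def by real_asymp
  have ln_nonneg: "ln (real s) \<ge> 0" for s :: nat by (cases "s = 0") auto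
  have eps0: "0 < eps0 s" "eps0 s \<le> 1 / 64" for s
  proof -
    have "(4 :: real)\<^sup>2 \<le> (ln (real s) + 4)\<^sup>2" using ln_nonneg[of s] by (intro power_mono) auto
    then have "16 \<le> (ln (real s) + 4)\<^sup>2" by simp
    then show "0 < eps0 s" "eps0 s \<le> 1 / 64"
      using frac_le[of 1 1 64 "4 * (ln (real s) + 4)\<^sup>2"] by (auto simp: eps0_def)
  qed
  have main: "real q \<ge> 1 / 5184 * (real s)\<^sup>2 / (ln (real s))\<^sup>2"
    if s1: "1 \<le> s" and sn: "s \<le> n" and alg: "nonadaptive_alg n q M" and dist: "distinguishes n M
          (\<lambda>A. ky_fan_norm s A > 1 / 10 / ln (real s) * real n)
          (\<lambda>A. ky_fan_norm s A < (1 - eps0 s) * (1 / 10 / ln (real s)) * real n)"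
    for n s q :: nat and M :: "det_alg measure"
  proof (cases "s = 1")
    case True
    \<comment> \<open>Here ln 1 = 0 and division by zero yields 0, so the claimed bound is q \<ge>
      0.\<close>
    then show ?thesis by simp
  next
    case False
    then have s: "s \<ge> 2" using s1 by simp
    define L where "L = ln (real s)"
    define l where "l = cycle_length s"
    define m where "m = s div l"
    define \<beta> where "\<beta> = n div (m * l)"
    define y where "y = pi / (2 * real l)"
    define T where "T = 1 / 10 / L * real n"
    define \<epsilon> where "\<epsilon> = eps0 s"
    \<comment> \<open>The scale makes the norm T / (1 - \<epsilon>) for block products -1 and T cos
      y / (1 - \<epsilon>) for block products 1. The first exceeds the threshold \<open>T\<close>
      strictly; the second lies below (1 - \<epsilon>) T as soon as cos y < (1 -
      \<epsilon>)^2.\<close>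
    define t where "t = T * sin y / ((1 - \<epsilon>) * (2 * real \<beta> * real m))"
    note len = cycle_length[OF s, folded l_def L_def]
    have "ln 2 \<le> L" using s by (simp add: L_def)
    then have L: "2 / 3 \<le> L" using ln2_ge_two_thirds by linarith
    have m: "m \<ge> 1" using len s by (simp add: m_def div_greater_zero_iff Suc_le_eq)
    have ml: "m * l \<le> s" by (simp add: m_def)
    have \<beta>: "\<beta> \<ge> 1" using ml sn m len by (simp add: \<beta>_def div_greater_zero_iff Suc_le_eq)
    have \<beta>n: "\<beta> * (m * l) \<le> n" by (simp add: \<beta>_def)
    have "n < m * l * Suc \<beta>" using dividend_less_times_div[of "m * l" n] m len by (simp add: \<beta>_def)
    also have "\<dots> \<le> 2 * \<beta> * m * l" using \<beta> by (simp add: algebra_simps)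
    finally have "real n \<le> real (2 * \<beta> * m * l)" by (simp only: of_nat_le_iff)
    then have n: "real n \<le> 2 * real \<beta> * real m * real l" by simp
    have T: "T > 0" using L sn s by (simp add: T_def)
    have \<epsilon>: "0 < \<epsilon>" "\<epsilon> \<le> 1 / 64" using eps0 by (auto simp: \<epsilon>_def)
    have y: "0 < y" "y \<le> pi / 2" "y < pi" using len by (auto simp: y_def field_simps)
    then have sin_y: "sin y > 0" by (intro sin_gt_zero)
    have t0: "t \<ge> 0" using T sin_y \<epsilon> by (simp add: t_def)
    \<comment> \<open>With sin y \<le> y and n \<le> 2 \<beta> m l the claim reduces to pi / (20 L)
      \<le> 1 - \<epsilon>. The constant c = 1/10 is small enough for this already at s = 2, where L
      is only known to be at least 2/3.\<close>
    have t1: "t \<le> 1"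
    proof -
      have "T * sin y \<le> T * y" using T y sin_x_le_x by (intro mult_left_mono) auto
      also have "\<dots> \<le> (1 / 10 / L * (2 * real \<beta> * real m * real l)) * y"
        unfolding T_def using n y L by (intro mult_right_mono mult_left_mono) auto
      also have "\<dots> = pi / (20 * L) * (2 * real \<beta> * real m)"
        using len by (simp add: y_def field_simps)
      also have "\<dots> \<le> (1 - \<epsilon>) * (2 * real \<beta> * real m)"
      proof (intro mult_right_mono)
        have "pi \<le> 4" using pi_less_4 by simp
        also have "4 \<le> (1 - \<epsilon>) * (20 * L)"
          using mult_mono[of "1 / 2" "1 - \<epsilon>" "20 * (2 / 3)" "20 * L"] L \<epsilon> by simp
        finally show "pi / (20 * L) \<le> 1 - \<epsilon>" using L by (simp add: field_simps)
      qed auto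
      finally show ?thesis unfolding t_def using \<beta> m \<epsilon> by (simp add: field_simps)
    qed
    have scale: "2 * t * real \<beta> * real m * (z / sin y) = T * z / (1 - \<epsilon>)" for z
      using \<beta> m sin_y \<epsilon> by (simp add: t_def field_simps)
    have props:
      "hard_matrix n m l \<beta> t w x \<in> carrier_mat n n"
      "max_norm (hard_matrix n m l \<beta> t w x) \<le> 1"
      "ky_fan_norm s (hard_matrix n m l \<beta> t w x) = T * (if d = 0 then cos y else 1) / (1 - \<epsilon>)"
      if "x \<in> signs m l d" "d \<le> 1" for w x d
      using hard_matrix_in_promise(1,2)[of l m \<beta> n s t d x w]
        hard_matrix_in_promise(3)[of l m \<beta> n s t d x w, folded y_def, unfolded scale]
        that len m \<beta> \<beta>n ml t0 t1
      by simp_all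
    have "T < T / (1 - \<epsilon>)" using T \<epsilon> by (simp add: field_simps)
    then have yes: "measure M {a \<in> space M. run_alg a (hard_matrix n m l \<beta> t w x)} \<ge> 3 / 4"
      if "x \<in> signs m l 1" for w x
      using dist props[OF that, of w] by (simp add: distinguishes_def T_def L_def)
    have gap: "cos y < (1 - \<epsilon>) * (1 - \<epsilon>)"
    proof -
      have "(2 * real l)\<^sup>2 \<le> (L + 4)\<^sup>2" using len(4) by (intro power_mono) auto
      then have "\<epsilon> \<le> 1 / (4 * (2 * real l)\<^sup>2)"
        unfolding \<epsilon>_def eps0_def L_def[symmetric] using len by (intro divide_left_mono) auto
      also have "\<dots> = 1 / (16 * (real l)\<^sup>2)" by (simp add: power_mult_distrib)
      finally have "2 * \<epsilon> \<le> 1 / (8 * (real l)\<^sup>2)" by simp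
      also have "\<dots> \<le> y\<^sup>2 / 8"
      proof -
        have "2 \<le> pi" by (rule pi_ge_two)
        then have "1\<^sup>2 \<le> (pi / 2)\<^sup>2" by (intro power_mono) auto
        moreover have "y\<^sup>2 = (pi / 2)\<^sup>2 / (real l)\<^sup>2" by (simp add: y_def power_divide power_mult_distrib)
        ultimately show ?thesis using len by (simp add: field_simps)
      qed
      finally have "cos y \<le> 1 - 2 * \<epsilon>" using cos_le_one_minus[of y] y by simp
      also have "\<dots> < (1 - \<epsilon>) * (1 - \<epsilon>)" using \<epsilon> by (simp add: algebra_simps)
      finally show ?thesis .
    qed
    have "T * cos y < T * ((1 - \<epsilon>) * (1 - \<epsilon>))" using mult_strict_left_mono[OF gap T] .
    then have "T * cos y / (1 - \<epsilon>) < (1 - \<epsilon>) * T"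
      using \<epsilon> by (simp add: pos_divide_less_eq mult_ac)
    then have no: "measure M {a \<in> space M. \<not> run_alg a (hard_matrix n m l \<beta> t w x)} \<ge> 3 / 4"
      if "x \<in> signs m l 0" for w x
      using dist props[OF that, of w] by (simp add: distinguishes_def T_def L_def \<epsilon>_def)
    have "real ((m * m) ^ l) \<le> 2 * real m * real q ^ l"
      using query_lower_bound[OF alg _ _ yes no] len m by simp
    then show ?thesis using queries_ge_of_power_bound[OF s l_def m_def] by blast
  qed
  have "eps0 s < 1" for s
    using eps0(2)[of s] by simp
  with theta eps0(1) main show ?thesis
    \<comment> \<open>With \<open>K = 1\<close> and \<open>p = 0\<close> the size condition reads s
      \<le> n, which is what gives at least one copy, \<beta> \<ge> 1.\<close>
    by - (rule exI[where x = "1 / 10"], rule exI[where x = eps0], rule exI[where x = 1],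
        rule exI[where x = 0], rule exI[where x = "1 / 5184"], rule exI[where x = 2], simp)
qed

end
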